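(* Let $\mathbb{L}\subset A\times I$ be an annular link. Then \[\dim_{\mathbb{C}}\mathrm{SKh}(\mathbb{L};k)\ \ge\ \dim_{\mathbb{C}}\mathrm{SKh}(\mathbb{L};k')\] whenever $k\equiv k' \bmod 2$ and $|k|\le|k'|$, where $\mathrm{SKh}(\mathbb{L};k)$ denotes the part of the sutured annular Khovanov homology of $\mathbb{L}$ in $k$-grading $k$.
   Context: All vector spaces are over $\mathbb{C}$. $A$ is a closed oriented annulus, $I=[0,1]$; an annular link is a link $\mathbb{L}\subset A\times I$, with diagram $\mathcal{P}\subset A$ obtained by generic projection. If $\mathcal{P}$ has $N$ crossings, then for $u\in\{0,1\}^N$ let $\mathcal{P}_u$ be the complete resolution (Khovanov's $0$/$1$-resolutions), a disjoint union of circles in $A$. A circle is trivial if it bounds a disk in $A$, nontrivial otherwise. Assign to $\mathcal{P}_u$ the tensor product over its circles of two-dimensional spaces with basis $w_+,w_-$ (trivial circles) or $v_+,v_-$ (nontrivial circles). The $k$-grading is additive under tensor product with $k(w_\pm)=0$, $k(v_\pm)=\pm1$. $\mathrm{CKh}(\mathcal{P})$ is the direct sum over $u$. Identify each circle's space with $\mathbb{C}[x]/(x^2)$ via $w_+,v_+\leftrightarrow1$, $w_-,v_-\leftrightarrow x$. Khovanov's differential $\partial$ is the sum over cube edges, with the standard signs, of the merge map (multiplication) or split map ($1\mapsto1\otimes x+x\otimes1$, $x\mapsto x\otimes x$). It decomposes as $\partial=\partial_0+\partial_-$ with $\partial_0$ of $k$-degree $0$ and $\partial_-$ of $k$-degree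 $-2$. The sutured annular Khovanov homology is $\mathrm{SKh}(\mathbb{L})=H(\mathrm{CKh}(\mathcal{P}),\partial_0)$; it is $k$-graded, and is an invariant of $\mathbb{L}$. *)

theory Defs
  imports "HOL-Analysis.Analysis" "HOL-Library.Function_Algebras"
begin

text \<open>
  The annulus is the round annulus in the plane with its standard orientation, and the
  second coordinate of the thickened annulus is the height used to tell over- from
  understrands.
\<close>

definition annulus :: "complex set" where
  "annulus = {z. 1 \<le> cmod z \<and> cmod z \<le> 2}"

definition thick_annulus :: "(complex \<times> real) set" where
  "thick_annulus = annulus \<times> {0..1}"

definition annular_link :: "(complex \<times> real) set \<Rightarrow> bool" where
  "annular_link L \<longleftrightarrow>
     L \<subseteq> thick_annulus \<and> finite (components L) \<and>
     (\<forall>K\<in>components L. K homeomorphic sphere (0::complex) 1)"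

text \<open>
  Isotopy of the ambient space through self-embeddings. The stages need not be surjective,
  so that a link touching the boundary may be pushed into the interior.
\<close>

definition annular_isotopic :: "(complex \<times> real) set \<Rightarrow> (complex \<times> real) set \<Rightarrow> bool" where
  "annular_isotopic L M \<longleftrightarrow>
     (\<exists>H :: real \<Rightarrow> complex \<times> real \<Rightarrow> complex \<times> real.
        continuous_on ({0..1} \<times> thick_annulus) (\<lambda>(t, p). H t p) \<and>
        (\<forall>t\<in>{0..1}. inj_on (H t) thick_annulus \<and> H t ` thick_annulus \<subseteq> thick_annulus) \<and>
        (\<forall>p\<in>thick_annulus. H 0 p = p) \<and>
        H 1 ` L = M)"


section \<open>Diagrams\<close>

record crossing =
  centre :: complex
  over_dir :: complex
  under_dir :: complex

text \<open>
  A diagram is recorded by a link in generic position, together with an enumeration of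
  its crossings and a common radius of small disks around them.
\<close>

record diagram =
  strands :: "(complex \<times> real) set"
  crossings :: "crossing list"
  radius :: real

text \<open>
  Above the disk of radius \<open>r\<close> around the crossing, the link consists of two strands
  projecting to diameters. The direction of the understrand is chosen so as to
  be counterclockwise, by an angle less than \<open>\<pi>\<close>, from that of the overstrand; this leaves
  only the freedom to negate both.
\<close>

definition crossing_chart :: "(complex \<times> real) set \<Rightarrow> real \<Rightarrow> crossing \<Rightarrow> bool" where
  "crossing_chart M r x \<longleftrightarrow>
     cmod (over_dir x) = 1 \<and> cmod (under_dir x) = 1 \<and>
     Im (cnj (over_dir x) * under_dir x) > 0 \<and>
     (\<exists>a b :: real \<Rightarrow> real.
        continuous_on {-r..r} a \<and> continuous_on {-r..r} b \<and> a 0 > b 0 \<and>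
        M \<inter> (cball (centre x) r \<times> UNIV) =
          (\<lambda>t. (centre x + t *\<^sub>R over_dir x, a t)) ` {-r..r} \<union>
          (\<lambda>t. (centre x + t *\<^sub>R under_dir x, b t)) ` {-r..r})"

definition annular_diagram :: "diagram \<Rightarrow> bool" where
  "annular_diagram D \<longleftrightarrow>
     annular_link (strands D) \<and> radius D > 0 \<and>
     distinct (map centre (crossings D)) \<and>
     (\<forall>p\<in>strands D. \<forall>q\<in>strands D.
        fst p = fst q \<and> p \<noteq> q \<longrightarrow> fst p \<in> centre ` set (crossings D)) \<and>
     (\<forall>x\<in>set (crossings D).
        cball (centre x) (radius D) \<subseteq> annulus \<and> crossing_chart (strands D) (radius D) x) \<and>
     (\<forall>x\<in>set (crossings D). \<forall>y\<in>set (crossings D). centre x \<noteq> centre y \<longrightarrow>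
        cball (centre x) (radius D) \<inter> cball (centre y) (radius D) = {})"

definition diagram_of :: "(complex \<times> real) set \<Rightarrow> diagram \<Rightarrow> bool" where
  "diagram_of L D \<longleftrightarrow> annular_diagram D \<and> annular_isotopic L (strands D)"


section \<open>Complete resolutions\<close>

text \<open>
  The regions swept out by rotating the overstrand counterclockwise lie between the over
  and under directions and between their negatives. The 0-smoothing (\<open>False\<close>) joins
  these two regions, the 1-smoothing (\<open>True\<close>) separates them.
\<close>

definition smoothing :: "real \<Rightarrow> crossing \<Rightarrow> bool \<Rightarrow> complex set" where
  "smoothing r x s =
     (let c = centre x; p = r *\<^sub>R over_dir x; q = r *\<^sub>R under_dir x in
      if s then closed_segment (c + p) (c + q) \<union> closed_segment (c - p) (c - q)
      else closed_segment (c + p) (c - q) \<union> closed_segment (c - p) (c + q))"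

definition resolution :: "diagram \<Rightarrow> bool list \<Rightarrow> complex set" where
  "resolution D u =
     (fst ` strands D - (\<Union>x\<in>set (crossings D). ball (centre x) (radius D))) \<union>
     (\<Union>i<length (crossings D). smoothing (radius D) (crossings D ! i) (u ! i))"

definition circles :: "diagram \<Rightarrow> bool list \<Rightarrow> complex set set" where
  "circles D u = components (resolution D u)"

text \<open>The set \<open>B\<close> is the interior of the disk bounded by the circle.\<close>

definition trivial_circle :: "complex set \<Rightarrow> bool" where
  "trivial_circle C \<longleftrightarrow>
     (\<exists>B. open B \<and> B \<subseteq> annulus \<and> B homeomorphic ball (0::complex) 1 \<and> frontier B = C)"


section \<open>The chain complex\<close>

text \<open>
  \<open>Plus\<close> stands for \<open>w\<^sub>+\<close> or \<open>v\<^sub>+\<close>, that is for \<open>1\<close>, and \<open>Minus\<close> for \<open>w\<^sub>-\<close> or \<open>v\<^sub>-\<close>, that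
  is for \<open>x\<close>. A standard basis vector of the chain space is a vertex of the cube with a
  labelling of its circles.
\<close>

datatype label = Plus | Minus

type_synonym state = "bool list \<times> (complex set \<Rightarrow> label)"

definition states :: "diagram \<Rightarrow> state set" where
  "states D =
     {(u, \<sigma>). length u = length (crossings D) \<and> \<sigma> \<in> circles D u \<rightarrow>\<^sub>E UNIV}"

definition k_grading :: "diagram \<Rightarrow> state \<Rightarrow> int" where
  "k_grading D = (\<lambda>(u, \<sigma>). \<Sum>C\<in>circles D u.
     if trivial_circle C then 0 else case \<sigma> C of Plus \<Rightarrow> 1 | Minus \<Rightarrow> -1)"

text \<open>
  The basis vectors occurring in the product of two basis vectors of \<open>\<complex>[x]/(x\<^sup>2)\<close>, and
  in the coproduct of one. All of them occur with coefficient 1.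
\<close>

fun merge :: "label \<Rightarrow> label \<Rightarrow> label set" where
  "merge Plus Plus = {Plus}"
| "merge Plus Minus = {Minus}"
| "merge Minus Plus = {Minus}"
| "merge Minus Minus = {}"

fun split :: "label \<Rightarrow> (label \<times> label) set" where
  "split Plus = {(Plus, Minus), (Minus, Plus)}"
| "split Minus = {(Minus, Minus)}"

text \<open>
  A circle that does not meet the disk of the changed crossing is a circle of both
  resolutions, as a subset of the plane; the circles meeting that disk belong to one of
  the two resolutions only.
\<close>

definition occurs_in_edge_map :: "diagram \<Rightarrow> state \<Rightarrow> state \<Rightarrow> bool" where
  "occurs_in_edge_map D = (\<lambda>(u, \<sigma>) (v, \<tau>).
     (\<forall>C\<in>circles D u \<inter> circles D v. \<tau> C = \<sigma> C) \<and>
     ((\<exists>C1 C2 C. C1 \<noteq> C2 \<and>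
         circles D u - circles D v = {C1, C2} \<and> circles D v - circles D u = {C} \<and>
         \<tau> C \<in> merge (\<sigma> C1) (\<sigma> C2)) \<or>
      (\<exists>C C1 C2. C1 \<noteq> C2 \<and>
         circles D u - circles D v = {C} \<and> circles D v - circles D u = {C1, C2} \<and>
         (\<tau> C1, \<tau> C2) \<in> split (\<sigma> C))))"

text \<open>The matrix entry of \<open>\<partial>\<close> from the basis vector \<open>S\<close> to the basis vector \<open>T\<close>.\<close>

definition boundary_entry :: "diagram \<Rightarrow> state \<Rightarrow> state \<Rightarrow> complex" where
  "boundary_entry D S T =
     (\<Sum>i | i < length (crossings D) \<and> \<not> fst S ! i \<and> fst T = (fst S)[i := True].
        if occurs_in_edge_map D S T then (-1) ^ card {j. j < i \<and> fst S ! j} else 0)"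

text \<open>The component \<open>\<partial>\<^sub>0\<close> of \<open>\<partial>\<close> of \<open>k\<close>-degree 0.\<close>

definition boundary0_entry :: "diagram \<Rightarrow> state \<Rightarrow> state \<Rightarrow> complex" where
  "boundary0_entry D S T =
     (if k_grading D T = k_grading D S then boundary_entry D S T else 0)"

definition boundary0 :: "diagram \<Rightarrow> (state \<Rightarrow> complex) \<Rightarrow> (state \<Rightarrow> complex)" where
  "boundary0 D \<psi> =
     (\<lambda>T. if T \<in> states D then \<Sum>S\<in>states D. boundary0_entry D S T * \<psi> S else 0)"

definition CKh :: "diagram \<Rightarrow> int \<Rightarrow> (state \<Rightarrow> complex) set" where
  "CKh D k = {\<psi>. \<forall>S. \<psi> S \<noteq> 0 \<longrightarrow> S \<in> states D \<and> k_grading D S = k}"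


section \<open>Homology\<close>

definition cscale :: "complex \<Rightarrow> ('s \<Rightarrow> complex) \<Rightarrow> ('s \<Rightarrow> complex)" where
  "cscale c \<psi> = (\<lambda>s. c * \<psi> s)"

global_interpretation chain: vector_space "cscale :: complex \<Rightarrow> ('s \<Rightarrow> complex) \<Rightarrow> _"
  by unfold_locales (auto simp: cscale_def fun_eq_iff algebra_simps)

definition quotient_space ::
    "('s \<Rightarrow> complex) set \<Rightarrow> ('s \<Rightarrow> complex) set \<Rightarrow> ('s \<Rightarrow> complex) set set" where
  "quotient_space Z B = Z // {(x, y). x \<in> Z \<and> y \<in> Z \<and> x - y \<in> B}"

text \<open>
  The dimension of a quotient space is the least number of vectors whose classes span it.
\<close>

definition quotient_dim :: "('s \<Rightarrow> complex) set set \<Rightarrow> nat" where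
  "quotient_dim Q =
     (LEAST n. \<exists>S. finite S \<and> card S = n \<and> S \<subseteq> \<Union>Q \<and> (\<forall>X\<in>Q. X \<inter> chain.span S \<noteq> {}))"

definition SKh :: "diagram \<Rightarrow> int \<Rightarrow> (state \<Rightarrow> complex) set set" where
  "SKh D k =
     quotient_space {\<psi> \<in> CKh D k. boundary0 D \<psi> = 0} (boundary0 D ` CKh D k)"

end

theory Submission
  imports Defs "HOL-Complex_Analysis.Riemann_Mapping"
begin

text \<open>
  On the span of \<open>v\<^sub>+\<close> and \<open>v\<^sub>-\<close> the Lie algebra \<open>sl\<^sub>2\<close> acts, and its action on the chain groups
  commutes with \<open>\<partial>\<^sub>0\<close> once the raising and lowering operators on a nontrivial circle are
  multiplied by the sign given by the parity of its nesting depth: two nontrivial circles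
  that merge into a trivial one (or arise by splitting one) are adjacent, so their signs are
  opposite, and the pairing \<open>v\<^sub>\<plusminus> \<otimes> v\<^sub>\<mp> \<mapsto> w\<^sub>-\<close> is invariant. Hence \<open>k\<close> is the weight grading of an
  \<open>sl\<^sub>2\<close>-representation on homology, where lowering is injective on positive weights, and
  exchanging \<open>v\<^sub>+\<close> and \<open>v\<^sub>-\<close> identifies the weights \<open>k\<close> and \<open>-k\<close>.

  The topological input is that the circles of a resolution are Jordan curves, that a
  nontrivial one separates 0 from infinity, and that a change of smoothing affects precisely
  the circles meeting the disk around the crossing.
\<close>

section \<open>Compact 1-manifolds, cut and glued along arcs\<close>

text \<open>The link is only a topological embedding, so nothing is known of its strands away from
  the crossing disks. Jordan curves therefore come from a class of compact 1-manifolds closed under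
  removing an open subarc and under attaching an arc at boundary points: the link is cut in space,
  projected, and closed up by chords.

  Adjacency of two changed nontrivial circles enters in a countable form. The crossing disk joins
  them without meeting any persisting circle, so both enclose the same persisting nontrivial
  circles; and of two disjoint nontrivial circles exactly one encloses the other. Hence their depths
  have opposite parity.

  Which merges and splits of trivial and nontrivial circles have to be treated is decided by weights
  instead of geometry: a matrix entry of k-degree 0 balances them, and the balance leaves only cases
  in which the signs are under control.

  Injectivity of lowering is derived from the commutator on chains, read modulo boundaries; the
  bounded range of weights makes raising nilpotent.\<close>

definition jordan_circle :: "'a::euclidean_space set \<Rightarrow> bool" where
  "jordan_circle c \<longleftrightarrow> (\<exists>g. simple_path g \<and> pathfinish g = pathstart g \<and> path_image g = c)"

definition arc_between :: "'a::euclidean_space \<Rightarrow> 'a \<Rightarrow> 'a set \<Rightarrow> bool" where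
  "arc_between p q a \<longleftrightarrow> (\<exists>g. arc g \<and> pathstart g = p \<and> pathfinish g = q \<and> path_image g = a)"

lemma arc_between_commute: "arc_between p q a \<longleftrightarrow> arc_between q p a"
  unfolding arc_between_def
  by (metis arc_reversepath path_image_reversepath pathfinish_reversepath pathstart_reversepath)

lemma arc_between_facts:
  assumes "arc_between p q a"
  shows "closed a" "compact a" "connected a" "p \<in> a" "q \<in> a" "p \<noteq> q"
  using assms unfolding arc_between_def
  by (auto simp: closed_arc_image compact_arc_image connected_arc_image dest: arc_distinct_ends)

lemma jordan_circle_facts:
  assumes "jordan_circle c"
  shows "closed c" "compact c" "connected c" "c \<noteq> {}"
  using assms unfolding jordan_circle_def
  by (auto simp: closed_simple_path_image compact_simple_path_image connected_simple_path_image)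

lemma arc_between_connected_interior:
  assumes "arc_between p q a" shows "connected (a - {p, q})"
  using assms unfolding arc_between_def
  by (metis arc_imp_simple_path connected_simple_path_endless)

text \<open>Pulled back along the parametrization, \<open>b\<close> is a connected subset of the
  unit interval containing both ends, hence all of it.\<close>

lemma arc_between_minimal:
  assumes a: "arc_between p q a" and b: "connected b" "b \<subseteq> a" "p \<in> b" "q \<in> b"
  shows "b = a"
proof -
  obtain g where g: "arc g" "pathstart g = p" "pathfinish g = q" "path_image g = a"
    using a unfolding arc_between_def by blast
  obtain h where h: "homeomorphism {0..1} (path_image g) g h"
    using homeomorphism_arc[OF g(1)] .
  have "connected (h ` b)"
    using b(1) by (rule connected_continuous_image[rotated])
      (use h b(2) g(4) in \<open>auto simp: homeomorphism_def intro: continuous_on_subset\<close>)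
  moreover have "h p = 0" "h q = 1"
    using h g(2,3) by (auto simp: homeomorphism_def pathstart_def pathfinish_def)
  moreover have "h p \<in> h ` b" "h q \<in> h ` b" using b(3,4) by blast+
  ultimately have "{0..1} \<subseteq> h ` b"
    using connected_contains_Icc[of "h ` b" 0 1] by simp
  moreover have "g ` h ` b = (\<lambda>y. y) ` b"
    unfolding image_image
    by (rule image_cong) (use h b(2) g(4) in \<open>auto simp: homeomorphism_def\<close>)
  ultimately have "g ` {0..1} \<subseteq> b" using image_mono[of "{0..1}" "h ` b" g] by simp
  then show ?thesis using b(2) g(4) by (auto simp: path_image_def)
qed

lemma connected_subset_closed_Un:
  fixes A :: "'a::t2_space set"
  assumes "connected S" "S \<subseteq> A \<union> B" "closed A" "closed B" "S \<inter> A \<inter> B = {}"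
  shows "S \<subseteq> A \<or> S \<subseteq> B"
  using connected_closedD[OF assms(1), of A B] assms(2-5) by blast

text \<open>The points \<open>p\<close> and \<open>q\<close> divide the circle into two arcs. The
  open arc \<open>a - {p, q}\<close> is connected, so it lies in one of them and by minimality fills
  it; the other one remains.\<close>

lemma jordan_circle_cut:
  assumes c: "jordan_circle c" and a: "arc_between p q a" and ac: "a \<subseteq> c"
  shows "arc_between p q (c - (a - {p, q}))"
proof -
  note af = arc_between_facts[OF a]
  obtain g where g: "simple_path g" "pathfinish g = pathstart g" "path_image g = c"
    using c unfolding jordan_circle_def by blast
  obtain u d where ud: "arc u" "arc d" "pathstart u = p" "pathfinish u = q"
      "pathstart d = q" "pathfinish d = p"
      "path_image u \<inter> path_image d = {p, q}" "path_image u \<union> path_image d = path_image g"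
    using exists_double_arc[OF g(1,2), of p q] af ac g(3) by (metis subsetD)
  have u: "arc_between p q (path_image u)" and d: "arc_between p q (path_image d)"
    using ud unfolding arc_between_def by (blast, metis arc_reversepath path_image_reversepath
      pathfinish_reversepath pathstart_reversepath)
  have "a - {p, q} \<subseteq> path_image u \<or> a - {p, q} \<subseteq> path_image d"
  proof (rule connected_subset_closed_Un[OF arc_between_connected_interior[OF a]])
    show "closed (path_image u)" "closed (path_image d)"
      using ud(1,2) by (simp_all add: closed_arc_image)
  qed (use ud(7,8) g(3) ac in auto)
  then consider "a \<subseteq> path_image u" | "a \<subseteq> path_image d" using ud(7) by blast
  then show ?thesis
  proof cases
    case 1
    then have "a = path_image u" using arc_between_minimal[OF u] af by blast
    then have "c - (a - {p, q}) = path_image d" using ud(7,8) g(3) by blast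
    then show ?thesis using d by simp
  next
    case 2
    then have "a = path_image d" using arc_between_minimal[OF d] af by blast
    then have "c - (a - {p, q}) = path_image u" using ud(7,8) g(3) by blast
    then show ?thesis using u by simp
  qed
qed

lemma arc_between_subarc:
  assumes "arc g" "x \<in> {0..1}" "y \<in> {0..1}" "x < y"
  shows "arc_between (g x) (g y) (g ` {x..y})"
  unfolding arc_between_def
  using arc_subpath_arc[OF assms(1-3)] assms(4)
  by (intro exI[of _ "subpath x y g"]) (simp add: path_image_subpath)

text \<open>By minimality \<open>a\<close> is the stretch of \<open>b\<close> between the parameters
  of its ends. These may be passed in either order along \<open>b\<close>, hence the renaming to
  \<open>p'\<close> and \<open>q'\<close>.\<close>

lemma arc_between_cut:
  assumes b: "arc_between s t b" and a: "arc_between p q a" and ab: "a \<subseteq> b" "s \<notin> a" "t \<notin> a"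
  shows "\<exists>b1 b2 p' q'. {p', q'} = {p, q} \<and> arc_between s p' b1 \<and> arc_between q' t b2 \<and>
    b1 \<inter> b2 = {} \<and> b1 \<union> b2 = b - (a - {p, q})"
proof -
  note af = arc_between_facts[OF a]
  obtain g where g: "arc g" "pathstart g = s" "pathfinish g = t" "path_image g = b"
    using b unfolding arc_between_def by blast
  have inj: "inj_on g {0..1}" using g(1) by (simp add: arc_def)
  have gb: "g ` {0..1} = b" using g(4) by (simp add: path_image_def)
  have st: "g 0 = s" "g 1 = t" using g(2,3) by (simp_all add: pathstart_def pathfinish_def)
  obtain x y where xy: "x \<in> {0..1}" "y \<in> {0..1}" "x < y" "{g x, g y} = {p, q}"
  proof -
    have "p \<in> g ` {0..1}" "q \<in> g ` {0..1}" using af(4,5) ab(1) gb by auto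
    then obtain x y where x: "x \<in> {0..1}" "p = g x" and y: "y \<in> {0..1}" "q = g y"
      by (elim imageE)
    then have "x \<noteq> y" using af(6) by auto
    then have "x < y \<or> y < x" by auto
    then show ?thesis
      using that[OF x(1) y(1)] that[OF y(1) x(1)] x(2) y(2) by (auto simp: insert_commute)
  qed
  have a': "arc_between (g x) (g y) a"
    using a xy(4) arc_between_commute by (metis doubleton_eq_iff)
  have gx: "g x \<in> a" "g y \<in> a" using xy(4) af(4,5) by auto
  \<comment> \<open>As \<open>s\<close> and \<open>t\<close> avoid \<open>a\<close>, neither
    remaining piece degenerates to a point.\<close>
  have x0: "0 < x" and y1: "y < 1"
    using xy(1,2) gx ab(2,3) st by (force simp: less_le)+
  obtain h where h: "homeomorphism {0..1} b g h"
    using homeomorphism_arc[OF g(1)] g(4) by metis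
  have "connected (h ` a)"
    by (rule connected_continuous_image[OF _ af(3)])
      (use h ab(1) in \<open>auto simp: homeomorphism_def intro: continuous_on_subset\<close>)
  moreover have "x \<in> h ` a" "y \<in> h ` a"
    using imageI[OF gx(1), of h] imageI[OF gx(2), of h] h xy(1,2) by (auto simp: homeomorphism_def)
  ultimately have "{x..y} \<subseteq> h ` a" using connected_contains_Icc[of "h ` a" x y] by simp
  then have "g ` {x..y} \<subseteq> g ` h ` a" by (rule image_mono)
  moreover have "g ` h ` a = (\<lambda>z. z) ` a"
    unfolding image_image
    by (rule image_cong) (use h ab(1) in \<open>auto simp: homeomorphism_def\<close>)
  ultimately have "g ` {x..y} \<subseteq> a" by simp
  moreover have "connected (g ` {x..y})"
    using arc_between_facts(3)[OF arc_between_subarc[OF g(1) xy(1-3)]] .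
  ultimately have axy: "a = g ` {x..y}"
    using arc_between_minimal[OF a', of "g ` {x..y}"] xy(3) by auto
  have 1: "arc_between s (g x) (g ` {0..x})"
    using arc_between_subarc[OF g(1), of 0 x] xy(1) x0 st(1) by auto
  have 2: "arc_between (g y) t (g ` {y..1})"
    using arc_between_subarc[OF g(1), of y 1] xy(2) y1 st(2) by auto
  have 3: "g ` {0..x} \<inter> g ` {y..1} = {}"
    using inj xy(1-3) by (auto dest!: inj_onD[of g "{0..1}"])
  have pq: "a - {p, q} = g ` ({x..y} - {x, y})"
  proof -
    have "a - {p, q} = g ` {x..y} - g ` {x, y}" using axy xy(4) by auto
    also have "\<dots> = g ` ({x..y} - {x, y})"
      by (rule inj_on_image_set_diff[OF inj, symmetric]) (use xy(1-3) in auto)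
    finally show ?thesis .
  qed
  have "b - (a - {p, q}) = g ` ({0..1} - ({x..y} - {x, y}))"
    unfolding pq gb[symmetric]
    by (rule inj_on_image_set_diff[OF inj, symmetric]) (use xy(1-3) in auto)
  also have "{0..1} - ({x..y} - {x, y}) = {0..x} \<union> {y..1}" using xy(1-3) by auto
  also have "g ` \<dots> = g ` {0..x} \<union> g ` {y..1}" by (rule image_Un)
  finally show ?thesis using 1 2 3 xy(4) by metis
qed

lemma arc_between_join:
  assumes "arc_between p q a" "arc_between q r b" "a \<inter> b = {q}"
  shows "arc_between p r (a \<union> b)"
proof -
  obtain g h where g: "arc g" "pathstart g = p" "pathfinish g = q" "path_image g = a"
    and h: "arc h" "pathstart h = q" "pathfinish h = r" "path_image h = b"
    using assms(1,2) unfolding arc_between_def by blast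
  have "arc (g +++ h)" using g h assms(3) by (intro arc_join) auto
  then show ?thesis unfolding arc_between_def using g h
    by (intro exI[of _ "g +++ h"]) (auto simp: path_image_join)
qed

lemma arc_between_join_circle:
  assumes "arc_between p q a" "arc_between p q b" "a \<inter> b = {p, q}"
  shows "jordan_circle (a \<union> b)"
proof -
  obtain g h where g: "arc g" "pathstart g = p" "pathfinish g = q" "path_image g = a"
    and h: "arc h" "pathstart h = q" "pathfinish h = p" "path_image h = b"
    using assms(1,2) arc_between_commute[of p q b] unfolding arc_between_def by blast
  have "simple_path (g +++ h)" using g h assms(3) by (intro simple_path_join_loop) auto
  then show ?thesis unfolding jordan_circle_def using g h
    by (intro exI[of _ "g +++ h"]) (auto simp: path_image_join)
qed

section \<open>Compact 1-manifolds with boundary\<close>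

text \<open>The second argument is the boundary.\<close>

inductive one_manifold :: "'a::euclidean_space set \<Rightarrow> 'a set \<Rightarrow> bool" where
  empty: "one_manifold {} {}"
| circle: "one_manifold X E \<Longrightarrow> jordan_circle c \<Longrightarrow> X \<inter> c = {} \<Longrightarrow> one_manifold (X \<union> c) E"
| arc: "one_manifold X E \<Longrightarrow> arc_between p q a \<Longrightarrow> X \<inter> a = {} \<Longrightarrow>
    one_manifold (X \<union> a) (E \<union> {p, q})"

lemma one_manifold_compact: "one_manifold X E \<Longrightarrow> compact X"
  by (induction rule: one_manifold.induct)
    (auto intro: compact_Un arc_between_facts jordan_circle_facts)

lemmas one_manifold_closed = one_manifold_compact[THEN compact_imp_closed]

lemma one_manifold_boundary: "one_manifold X E \<Longrightarrow> E \<subseteq> X"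
  by (induction rule: one_manifold.induct) (auto intro: arc_between_facts)

text \<open>Serves to carry the structure from space to the plane: the projection becomes injective
  once the crossings have been cut out.\<close>

lemma one_manifold_image:
  assumes "one_manifold X E" "continuous_on X f" "inj_on f X"
  shows "one_manifold (f ` X) (f ` E)"
  using assms
proof (induction rule: one_manifold.induct)
  case empty
  then show ?case by (simp add: one_manifold.empty)
next
  case (circle X E c)
  obtain g where g: "simple_path g" "pathfinish g = pathstart g" "path_image g = c"
    using circle.hyps unfolding jordan_circle_def by blast
  have "simple_path (f \<circ> g)"
    using circle.prems g by (intro simple_path_continuous_image)
      (auto intro: continuous_on_subset inj_on_subset)
  then have "jordan_circle (f ` c)" unfolding jordan_circle_def
    using g by (intro exI[of _ "f \<circ> g"]) (auto simp: path_image_compose pathfinish_compose pathstart_compose)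
  moreover have "f ` X \<inter> f ` c = {}" using circle.prems(2) circle.hyps(3)
    by (auto simp: inj_on_def)
  moreover have "one_manifold (f ` X) (f ` E)"
    using circle.prems by (intro circle.IH) (auto intro: continuous_on_subset inj_on_subset)
  ultimately show ?case unfolding image_Un by (intro one_manifold.circle)
next
  case (arc X E p q a)
  obtain g where g: "arc g" "pathstart g = p" "pathfinish g = q" "path_image g = a"
    using arc.hyps unfolding arc_between_def by blast
  have "arc (f \<circ> g)" unfolding arc_def
  proof
    show "path (f \<circ> g)"
      using arc.prems g by (intro path_continuous_image) (auto intro: continuous_on_subset arc_imp_path)
    show "inj_on (f \<circ> g) {0..1}"
      using arc.prems(2) g by (intro comp_inj_on) (auto simp: arc_def path_image_def intro: inj_on_subset)
  qed
  then have "arc_between (f p) (f q) (f ` a)" unfolding arc_between_def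
    using g by (intro exI[of _ "f \<circ> g"]) (auto simp: path_image_compose pathfinish_compose pathstart_compose)
  moreover have "f ` X \<inter> f ` a = {}" using arc.prems(2) arc.hyps(3)
    by (auto simp: inj_on_def)
  moreover have "one_manifold (f ` X) (f ` E)"
    using arc.prems by (intro arc.IH) (auto intro: continuous_on_subset inj_on_subset)
  ultimately have "one_manifold (f ` X \<union> f ` a) (f ` E \<union> {f p, f q})"
    by (intro one_manifold.arc)
  then show ?case by (simp add: image_Un)
qed

text \<open>Being connected, \<open>a\<close> lies in a single piece. Its removal turns a circle
  into an arc and an arc into two arcs; the ends of \<open>a\<close> stay and become boundary
  points.\<close>

lemma one_manifold_cut:
  assumes "one_manifold X E" "arc_between p q a" "a \<subseteq> X" "a \<inter> E = {}"
  shows "one_manifold (X - (a - {p, q})) (E \<union> {p, q})"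
  using assms(1,3,4)
proof (induction rule: one_manifold.induct)
  case empty
  then show ?case using arc_between_facts[OF assms(2)] by auto
next
  case (circle X E c)
  have "a \<subseteq> X \<or> a \<subseteq> c"
    by (rule connected_subset_closed_Un[OF arc_between_facts(3)[OF assms(2)] circle.prems(1)])
      (use circle.hyps one_manifold_closed jordan_circle_facts(1) in auto)
  then show ?case
  proof
    assume aX: "a \<subseteq> X"
    then have "one_manifold (X - (a - {p, q}) \<union> c) (E \<union> {p, q})"
      using circle by (intro one_manifold.circle) auto
    moreover have "X - (a - {p, q}) \<union> c = X \<union> c - (a - {p, q})" using aX circle.hyps by auto
    ultimately show ?thesis by simp
  next
    assume ac: "a \<subseteq> c"
    then have "one_manifold (X \<union> (c - (a - {p, q}))) (E \<union> {p, q})"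
      using circle by (intro one_manifold.arc jordan_circle_cut[OF _ assms(2)]) auto
    moreover have "X \<union> (c - (a - {p, q})) = X \<union> c - (a - {p, q})" using ac circle.hyps by auto
    ultimately show ?thesis by simp
  qed
next
  case (arc X E s t b)
  have "a \<subseteq> X \<or> a \<subseteq> b"
    by (rule connected_subset_closed_Un[OF arc_between_facts(3)[OF assms(2)] arc.prems(1)])
      (use arc.hyps one_manifold_closed arc_between_facts(1) in auto)
  then show ?case
  proof
    assume aX: "a \<subseteq> X"
    then have "one_manifold (X - (a - {p, q}) \<union> b) (E \<union> {p, q} \<union> {s, t})"
      using arc by (intro one_manifold.arc) auto
    moreover have "X - (a - {p, q}) \<union> b = X \<union> b - (a - {p, q})" using aX arc.hyps by auto
    ultimately show ?thesis by (simp add: insert_commute)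
  next
    assume ab: "a \<subseteq> b"
    then obtain b1 b2 p' q' where b: "{p', q'} = {p, q}" "arc_between s p' b1"
        "arc_between q' t b2" "b1 \<inter> b2 = {}" "b1 \<union> b2 = b - (a - {p, q})"
      using arc_between_cut[OF arc.hyps(2) assms(2) ab] arc.prems(2) by auto
    have "one_manifold (X \<union> b1 \<union> b2) (E \<union> {s, p'} \<union> {q', t})"
      using arc.hyps b by (intro one_manifold.arc) auto
    moreover have "X \<union> b1 \<union> b2 = X \<union> b - (a - {p, q})"
      using b(5) ab arc.hyps by auto
    moreover have "E \<union> {s, p'} \<union> {q', t} = E \<union> {s, t} \<union> {p, q}" using b(1) by auto
    ultimately show ?thesis by simp
  qed
qed

text \<open>The inductive construction adds the pieces in some order; this makes the arc ending at
  \<open>p\<close> the last one, so that it can be exchanged for a longer piece.\<close>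

lemma one_manifold_arc_at_boundary:
  assumes "one_manifold X E" "p \<in> E"
  shows "\<exists>X' E' q a. one_manifold X' E' \<and> arc_between p q a \<and> X' \<inter> a = {} \<and>
    X = X' \<union> a \<and> E' = E - {p, q} \<and> q \<in> E"
  using assms
proof (induction rule: one_manifold.induct)
  case empty
  then show ?case by simp
next
  case (circle X E c)
  then obtain X' E' q a where *: "one_manifold X' E'" "arc_between p q a" "X' \<inter> a = {}"
      "X = X' \<union> a" "E' = E - {p, q}" "q \<in> E" by blast
  then have "one_manifold (X' \<union> c) E'" using circle.hyps by (intro one_manifold.circle) auto
  moreover have "(X' \<union> c) \<inter> a = {}" "X \<union> c = (X' \<union> c) \<union> a" using * circle.hyps by auto
  ultimately show ?case using * by blast
next
  case (arc X E s t b)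
  have bE: "E \<inter> b = {}" using one_manifold_boundary[OF arc.hyps(1)] arc.hyps(3) by auto
  note bf = arc_between_facts[OF arc.hyps(2)]
  show ?case
  proof (cases "p \<in> E")
    case True
    then obtain X' E' q a where *: "one_manifold X' E'" "arc_between p q a" "X' \<inter> a = {}"
        "X = X' \<union> a" "E' = E - {p, q}" "q \<in> E" using arc.IH by blast
    then have "one_manifold (X' \<union> b) (E' \<union> {s, t})" using arc.hyps by (intro one_manifold.arc) auto
    moreover have "(X' \<union> b) \<inter> a = {}" "X \<union> b = (X' \<union> b) \<union> a" using * arc.hyps by auto
    moreover have "E' \<union> {s, t} = E \<union> {s, t} - {p, q}" using * True bE bf by auto
    ultimately show ?thesis using * by blast
  next
    case False
    then have "p = s \<or> p = t" using arc.prems by blast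
    then obtain q where q: "arc_between p q b" "{p, q} = {s, t}"
      using arc.hyps(2) arc_between_commute by (metis insert_commute)
    have "E = E \<union> {s, t} - {p, q}" using q(2) bE bf by auto
    then show ?thesis using q arc.hyps by (metis Un_iff insertCI)
  qed
qed

text \<open>If both ends of \<open>a\<close> belong to the same arc, that arc closes up to a circle;
  otherwise \<open>a\<close> joins two arcs into one.\<close>

lemma one_manifold_glue:
  assumes X: "one_manifold X E" and a: "arc_between p q a" and int: "a \<inter> X = {p, q}" "{p, q} \<subseteq> E"
  shows "one_manifold (X \<union> a) (E - {p, q})"
proof -
  obtain X1 E1 r b where 1: "one_manifold X1 E1" "arc_between p r b" "X1 \<inter> b = {}"
      "X = X1 \<union> b" "E1 = E - {p, r}" "r \<in> E"
    using one_manifold_arc_at_boundary[OF X, of p] int by auto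
  note bf = arc_between_facts[OF 1(2)]
  note af = arc_between_facts[OF a]
  show ?thesis
  proof (cases "r = q")
    case True
    have "jordan_circle (b \<union> a)"
    proof (rule arc_between_join_circle[OF _ a])
      show "arc_between p q b" using 1(2) True by simp
      show "b \<inter> a = {p, q}" using int(1) 1(4) bf True by auto
    qed
    then have "one_manifold (X1 \<union> (b \<union> a)) E1"
      using 1 int(1) bf True by (intro one_manifold.circle) auto
    then show ?thesis using 1 True by (simp add: Un_assoc)
  next
    case False
    have "q \<in> E1" using 1(5) False int(2) af by auto
    then obtain X2 E2 s c where 2: "one_manifold X2 E2" "arc_between q s c" "X2 \<inter> c = {}"
        "X1 = X2 \<union> c" "E2 = E1 - {q, s}" "s \<in> E1"
      using one_manifold_arc_at_boundary[OF 1(1)] by blast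
    note cf = arc_between_facts[OF 2(2)]
    have ac: "arc_between p s (a \<union> c)"
      by (rule arc_between_join[OF a 2(2)]) (use int(1) 1 2 bf cf in auto)
    have "arc_between r s (b \<union> (a \<union> c))"
      by (rule arc_between_join[OF _ ac])
        (use 1 2 int(1) bf af cf arc_between_commute[of p r b] in auto)
    then have "one_manifold (X2 \<union> (b \<union> (a \<union> c))) (E2 \<union> {r, s})"
      using 1 2 int(1) bf cf by (intro one_manifold.arc[OF 2(1)]) auto
    moreover have "X2 \<union> (b \<union> (a \<union> c)) = X \<union> a" using 1 2 by auto
    moreover have "r \<noteq> p" using bf by auto
    then have "E2 \<union> {r, s} = E - {p, q}" using 1(5,6) 2(5,6) False cf by auto
    ultimately show ?thesis by simp
  qed
qed

section \<open>Components of a 1-manifold\<close>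

lemma component_of_disjoint_Un:
  fixes X :: "'a::euclidean_space set"
  assumes "closed X" "closed c" "connected c" "c \<noteq> {}" "X \<inter> c = {}"
  shows "components (X \<union> c) = insert c (components X)"
proof -
  have sub: "K \<subseteq> X \<or> K \<subseteq> c" if "K \<in> components (X \<union> c)" for K
    using connected_subset_closed_Un[OF in_components_connected[OF that] in_components_subset[OF that]]
      assms by auto
  have c: "c \<in> components (X \<union> c)"
  proof -
    obtain K where K: "K \<in> components (X \<union> c)" "c \<subseteq> K"
      using exists_component_superset[of c "X \<union> c"] assms by auto
    then show ?thesis using sub[OF K(1)] assms by (metis Int_absorb1 inf.orderE inf_commute subset_antisym subset_trans)
  qed
  show ?thesis
  proof (intro set_eqI iffI)
    fix K assume K: "K \<in> components (X \<union> c)"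
    show "K \<in> insert c (components X)"
    proof (cases "K = c")
      case False
      then have "K \<inter> c = {}" using components_nonoverlap[OF K c] by simp
      then have "K \<subseteq> X" using in_components_subset[OF K] by auto
      then show ?thesis using components_intermediate_subset[OF K, of X] by auto
    qed simp
  next
    fix K assume "K \<in> insert c (components X)"
    then show "K \<in> components (X \<union> c)"
    proof
      assume K: "K \<in> components X"
      then have KX: "K \<subseteq> X" "connected K" "K \<noteq> {}"
        by (auto dest: in_components_subset in_components_connected in_components_nonempty)
      obtain J where J: "J \<in> components (X \<union> c)" "K \<subseteq> J"
        using exists_component_superset[of K "X \<union> c"] KX by auto
      have "J \<subseteq> X" using sub[OF J(1)] J(2) KX assms(5) by blast
      then have "J \<subseteq> K"
        using components_maximal[OF K in_components_connected[OF J(1)]] J(2) KX by blast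
      then show ?thesis using J by auto
    qed (use c in simp)
  qed
qed

lemma one_manifold_components:
  assumes "one_manifold X E" "E = {}"
  shows "finite (components X) \<and> (\<forall>c\<in>components X. jordan_circle c)"
  using assms
proof (induction rule: one_manifold.induct)
  case (circle X E c)
  have "components (X \<union> c) = insert c (components X)"
    using circle.hyps jordan_circle_facts[OF circle.hyps(2)] one_manifold_closed
    by (intro component_of_disjoint_Un) auto
  then show ?case using circle by auto
qed auto

lemma jordan_circle_homeomorphic:
  fixes K :: "'a::euclidean_space set"
  assumes "K homeomorphic sphere (0::complex) 1"
  shows "jordan_circle K"
proof -
  obtain h k where h: "homeomorphism (sphere (0::complex) 1) K h k"
    using assms homeomorphic_sym unfolding homeomorphic_def by blast
  define g where "g = circlepath (0::complex) 1"
  have g: "simple_path g" "pathfinish g = pathstart g" "path_image g = sphere 0 1"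
    by (simp_all add: g_def simple_path_circlepath)
  have "simple_path (h \<circ> g)"
    using h g by (intro simple_path_continuous_image)
     (auto simp: homeomorphism_def intro: inj_on_inverseI)
  then show ?thesis unfolding jordan_circle_def using h g
    by (intro exI[of _ "h \<circ> g"])
      (auto simp: path_image_compose pathfinish_compose pathstart_compose homeomorphism_def)
qed

lemma one_manifold_of_components:
  assumes "finite (components M)" "\<And>K. K \<in> components M \<Longrightarrow> jordan_circle K"
  shows "one_manifold M {}"
proof -
  have "one_manifold (\<Union>F) {}" if "finite F" "F \<subseteq> components M" for F
    using that
  proof (induction rule: finite_induct)
    case empty
    then show ?case by (simp add: one_manifold.empty)
  next
    case (insert K F)
    have "\<Union>F \<inter> K = {}"
    proof -
      have "J \<inter> K = {}" if "J \<in> F" for J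
        using components_nonoverlap[of J M K] insert that by auto
      then show ?thesis by auto
    qed
    then have "one_manifold (\<Union>F \<union> K) {}"
      using insert assms(2) by (intro one_manifold.circle) auto
    then show ?case by (simp add: Un_commute)
  qed
  from this[OF assms(1)] show ?thesis by (simp)
qed

section \<open>Cutting and gluing along disjoint families of arcs\<close>

lemma one_manifold_cut_family:
  assumes "finite I" "one_manifold X E"
    and "\<And>i. i \<in> I \<Longrightarrow> arc_between (p i) (q i) (a i) \<and> a i \<subseteq> X \<and> a i \<inter> E = {}"
    and "\<And>i j. i \<in> I \<Longrightarrow> j \<in> I \<Longrightarrow> i \<noteq> j \<Longrightarrow> a i \<inter> a j = {}"
  shows "one_manifold (X - (\<Union>i\<in>I. a i - {p i, q i})) (E \<union> (\<Union>i\<in>I. {p i, q i}))"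
  using assms(1,3,4)
proof (induction I rule: finite_induct)
  case empty
  then show ?case using assms(2) by simp
next
  case (insert i I)
  let ?X = "X - (\<Union>i\<in>I. a i - {p i, q i})" and ?E = "E \<union> (\<Union>i\<in>I. {p i, q i})"
  have disj: "a i \<inter> a j = {}" if "j \<in> I" for j using insert.prems(2)[of i j] insert.hyps(2) that by auto
  have ai: "arc_between (p i) (q i) (a i)" "a i \<subseteq> X" "a i \<inter> E = {}"
    using insert.prems(1)[of i] by auto
  have "p j \<in> a j" "q j \<in> a j" if "j \<in> I" for j
    using insert.prems(1)[of j] that arc_between_facts[of "p j" "q j" "a j"] by auto
  then have "a i \<inter> ?E = {}" using disj ai(3) by blast
  moreover have "a i \<subseteq> ?X" using disj ai(2) by blast
  moreover have "one_manifold ?X ?E"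
    by (rule insert.IH; use insert.prems in simp)
  ultimately have "one_manifold (?X - (a i - {p i, q i})) (?E \<union> {p i, q i})"
    by (intro one_manifold_cut[OF _ ai(1)])
  moreover have "?X - (a i - {p i, q i}) = X - (\<Union>i\<in>insert i I. a i - {p i, q i})" by auto
  moreover have "?E \<union> {p i, q i} = E \<union> (\<Union>i\<in>insert i I. {p i, q i})" by auto
  ultimately show ?case by simp
qed

lemma one_manifold_glue_family:
  assumes "finite I" "one_manifold X E"
    and "\<And>i. i \<in> I \<Longrightarrow> arc_between (p i) (q i) (a i) \<and> a i \<inter> X = {p i, q i} \<and> {p i, q i} \<subseteq> E"
    and "\<And>i j. i \<in> I \<Longrightarrow> j \<in> I \<Longrightarrow> i \<noteq> j \<Longrightarrow> a i \<inter> a j = {}"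
  shows "one_manifold (X \<union> (\<Union>i\<in>I. a i)) (E - (\<Union>i\<in>I. {p i, q i}))"
  using assms(1,3,4)
proof (induction I rule: finite_induct)
  case empty
  then show ?case using assms(2) by simp
next
  case (insert i I)
  let ?X = "X \<union> (\<Union>i\<in>I. a i)" and ?E = "E - (\<Union>i\<in>I. {p i, q i})"
  have disj: "a i \<inter> a j = {}" if "j \<in> I" for j using insert.prems(2)[of i j] insert.hyps(2) that by auto
  have ai: "arc_between (p i) (q i) (a i)" "a i \<inter> X = {p i, q i}" "{p i, q i} \<subseteq> E"
    using insert.prems(1)[of i] by auto
  have "p j \<in> a j" "q j \<in> a j" if "j \<in> I" for j
    using insert.prems(1)[of j] that arc_between_facts[of "p j" "q j" "a j"] by auto
  then have "{p i, q i} \<subseteq> ?E" using disj ai(2,3) by blast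
  moreover have "a i \<inter> ?X = {p i, q i}" using disj ai(2) by blast
  moreover have "one_manifold ?X ?E"
    by (rule insert.IH; use insert.prems in simp)
  ultimately have "one_manifold (?X \<union> a i) (?E - {p i, q i})"
    by (intro one_manifold_glue[OF _ ai(1)])
  moreover have "?X \<union> a i = X \<union> (\<Union>i\<in>insert i I. a i)" by auto
  moreover have "?E - {p i, q i} = E - (\<Union>i\<in>insert i I. {p i, q i})" by auto
  ultimately show ?case by simp
qed

section \<open>Chords of a disk and directions at a crossing\<close>

lemma arc_between_segment: "a \<noteq> b \<Longrightarrow> arc_between a b (closed_segment a b)"
  unfolding arc_between_def by (intro exI[of _ "linepath a b"]) (simp add: arc_linepath)

lemma chord_Int_sphere:
  fixes c :: "'a::euclidean_space"
  assumes "dist c a = r" "dist c b = r" "z \<in> closed_segment a b" "dist c z \<ge> r"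
  shows "z \<in> {a, b}"
  using assms dist_decreases_open_segment[of z a b c] by (auto simp: open_segment_def)

text \<open>\<open>Im (cnj d * e)\<close> is the determinant of \<open>d\<close> and
  \<open>e\<close>, so the orientation condition at a crossing makes the two strand directions a
  real basis of the plane.\<close>

lemma independent_directions:
  fixes d e :: complex and s t :: real
  assumes "Im (cnj d * e) > 0" "s *\<^sub>R d + t *\<^sub>R e = 0"
  shows "s = 0 \<and> t = 0"
proof -
  have "cnj d * (s *\<^sub>R d + t *\<^sub>R e) = s *\<^sub>R (d * cnj d) + t *\<^sub>R (cnj d * e)"
    by (simp add: algebra_simps)
  then have "Im (s *\<^sub>R (d * cnj d) + t *\<^sub>R (cnj d * e)) = 0" using assms(2) by simp
  then have "t * Im (cnj d * e) = 0" by simp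
  then have t: "t = 0" using assms(1) by (metis less_irrefl mult_eq_0_iff)
  then have "s = 0 \<or> d = 0" using assms(2) by simp
  then show ?thesis using t assms(1) by auto
qed

section \<open>The circles of a resolution\<close>

locale annular_resolutions =
  fixes D :: diagram
  assumes D: "annular_diagram D"
begin

abbreviation "n \<equiv> length (crossings D)"
abbreviation "r \<equiv> radius D"
abbreviation "ctr i \<equiv> centre (crossings D ! i)"
abbreviation "dir i b \<equiv> (if b then over_dir (crossings D ! i) else under_dir (crossings D ! i))"
abbreviation "outer \<equiv> fst ` strands D - (\<Union>x\<in>set (crossings D). ball (centre x) r)"

text \<open>
  The smoothing \<open>s\<close> of crossing \<open>i\<close> consists of two chords, told apart by whether their end on
  the overstrand lies ahead of the centre (\<open>b\<close>); \<open>e\<close> selects this end of the chord.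
\<close>

definition chord_end :: "nat \<Rightarrow> bool \<Rightarrow> bool \<Rightarrow> bool \<Rightarrow> complex" where
  "chord_end i s b e = ctr i + (if b then r else - r) *\<^sub>R
    (if e then dir i True else if s then dir i False else - dir i False)"

definition chord :: "nat \<Rightarrow> bool \<Rightarrow> bool \<Rightarrow> complex set" where
  "chord i s b = closed_segment (chord_end i s b True) (chord_end i s b False)"

lemma radius_pos: "r > 0"
  using D by (simp add: annular_diagram_def)

lemma crossing_facts:
  assumes "i < n"
  shows "cmod (dir i b) = 1" "Im (cnj (dir i True) * dir i False) > 0"
    "cball (ctr i) r \<subseteq> annulus" "crossing_chart (strands D) r (crossings D ! i)"
  using D nth_mem[OF assms] by (auto simp: annular_diagram_def crossing_chart_def)

lemma crossing_disks_disjoint: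
  assumes "i < n" "j < n" "i \<noteq> j" shows "cball (ctr i) r \<inter> cball (ctr j) r = {}"
proof -
  have "distinct (map centre (crossings D))" using D by (simp add: annular_diagram_def)
  then have "ctr i \<noteq> ctr j" using assms by (metis length_map nth_eq_iff_index_eq nth_map)
  then show ?thesis using D nth_mem assms(1,2) unfolding annular_diagram_def by blast
qed

lemma smoothing_chords: "smoothing r (crossings D ! i) s = chord i s True \<union> chord i s False"
  by (auto simp: smoothing_def chord_def chord_end_def Let_def)

lemma chord_end_dist: "i < n \<Longrightarrow> dist (ctr i) (chord_end i s b e) = r"
  using radius_pos crossing_facts(1)[of i True] crossing_facts(1)[of i False]
  by (simp add: chord_end_def dist_norm)

lemma chord_in_disk: assumes "i < n" shows "chord i s b \<subseteq> cball (ctr i) r"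
  unfolding chord_def
  by (rule closed_segment_subset) (auto simp: chord_end_dist[OF assms])

lemma chord_param:
  assumes "z \<in> chord i s b"
  obtains t where "0 \<le> t" "t \<le> 1" "z = ctr i + (if b then r else - r) *\<^sub>R
    ((1 - t) *\<^sub>R dir i True + (if s then t else - t) *\<^sub>R dir i False)"
proof -
  obtain t where "0 \<le> t" "t \<le> 1"
    "z = (1 - t) *\<^sub>R chord_end i s b True + t *\<^sub>R chord_end i s b False"
    using assms unfolding chord_def closed_segment_def by blast
  then show ?thesis
    by (intro that[of t]) (auto simp: chord_end_def algebra_simps)
qed

text \<open>In the basis of the strand directions each chord lies on a line
  \<open>x + y = \<plusminus>r\<close> or \<open>x - y = \<plusminus>r\<close> within one closed
  quadrant. Chords can then be told apart by signs alone.\<close>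

lemma chord_coordinates:
  assumes "i < n" "z \<in> chord i s b" "z = ctr i + x *\<^sub>R dir i True + y *\<^sub>R dir i False"
  shows "x + (if s then y else - y) = (if b then r else - r)"
    "if b then x \<ge> 0 else x \<le> 0" "if b = s then y \<ge> 0 else y \<le> 0"
proof -
  obtain t where t: "0 \<le> t" "t \<le> 1" "z = ctr i + (if b then r else - r) *\<^sub>R
    ((1 - t) *\<^sub>R dir i True + (if s then t else - t) *\<^sub>R dir i False)"
    using chord_param[OF assms(2)] .
  define w where "w = (if b then r else - r)"
  define v where "v = (if s then t else - t)"
  have "(x - w * (1 - t)) *\<^sub>R dir i True + (y - w * v) *\<^sub>R dir i False = 0"
    using t(3) assms(3) unfolding w_def[symmetric] v_def[symmetric] by (simp add: algebra_simps)
  then have xy: "x = w * (1 - t)" "y = w * v"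
    using independent_directions[OF crossing_facts(2)[OF assms(1)]] by force+
  show "x + (if s then y else - y) = (if b then r else - r)"
    using xy by (auto simp: w_def v_def algebra_simps)
  show "if b then x \<ge> 0 else x \<le> 0" "if b = s then y \<ge> 0 else y \<le> 0"
    using t radius_pos unfolding xy w_def v_def by (auto simp: mult_nonneg_nonpos)
qed

lemma chords_disjoint:
  assumes "i < n" shows "chord i s True \<inter> chord i s False = {}"
proof (rule ccontr)
  assume "\<not> ?thesis"
  then obtain z where z: "z \<in> chord i s True" "z \<in> chord i s False" by blast
  obtain t where t: "z = ctr i + r *\<^sub>R
    ((1 - t) *\<^sub>R dir i True + (if s then t else - t) *\<^sub>R dir i False)"
    using chord_param[OF z(1)] by auto
  have "z = ctr i + (r * (1 - t)) *\<^sub>R dir i True + (r * (if s then t else - t)) *\<^sub>R dir i False"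
    using t by (simp add: algebra_simps)
  from chord_coordinates(1)[OF assms z(1) this] chord_coordinates(1)[OF assms z(2) this]
  show False using radius_pos by simp
qed

lemma chord_end_neq:
  assumes "i < n" shows "chord_end i s b True \<noteq> chord_end i s b False"
proof
  assume eq: "chord_end i s b True = chord_end i s b False"
  have z: "chord_end i s b True \<in> chord i s b" by (simp add: chord_def)
  have "chord_end i s b True = ctr i + (if b then r else - r) *\<^sub>R dir i True + 0 *\<^sub>R dir i False"
    by (simp add: chord_end_def)
  moreover have "chord_end i s b True = ctr i + 0 *\<^sub>R dir i True +
    ((if b then r else - r) * (if s then 1 else - 1)) *\<^sub>R dir i False"
    unfolding eq by (simp add: chord_end_def)
  ultimately have "(if b then r else - r) *\<^sub>R dir i True +
    (- ((if b then r else - r) * (if s then 1 else - 1))) *\<^sub>R dir i False = 0"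
    by (simp add: algebra_simps)
  then show False using independent_directions[OF crossing_facts(2)[OF assms]] radius_pos
    by (metis neg_equal_0_iff_equal less_irrefl)
qed

lemma chord_arc: "i < n \<Longrightarrow> arc_between (chord_end i s b True) (chord_end i s b False) (chord i s b)"
  unfolding chord_def by (intro arc_between_segment chord_end_neq)

text \<open>The two smoothings share their four end points, so an interior point has to distinguish
  them: the coordinates of the midpoint have equal signs for the 1-smoothing and opposite signs for
  the 0-smoothing.\<close>

lemma chord_midpoint_notin:
  assumes "i < n" "s \<noteq> s'"
  shows "midpoint (chord_end i s b True) (chord_end i s b False) \<notin> chord i s' b'"
proof
  let ?z = "midpoint (chord_end i s b True) (chord_end i s b False)"
  assume z': "?z \<in> chord i s' b'"
  have "?z = ctr i + ((if b then r else - r) / 2) *\<^sub>R dir i True +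
    ((if b then r else - r) / 2 * (if s then 1 else - 1)) *\<^sub>R dir i False"
    by (simp add: chord_end_def midpoint_def algebra_simps scaleR_2[symmetric])
  from chord_coordinates[OF assms(1) z' this] show False using radius_pos assms(2)
    by (auto split: if_splits)
qed

section \<open>The link outside the crossing disks\<close>

lemma strands_in_disk:
  assumes "i < n"
  shows "\<exists>h. (\<forall>b. continuous_on {-r..r} (h b)) \<and> h True 0 > h False 0 \<and>
    strands D \<inter> (cball (ctr i) r \<times> UNIV) = (\<Union>b. (\<lambda>t. (ctr i + t *\<^sub>R dir i b, h b t)) ` {-r..r})"
proof -
  obtain a b where ab: "continuous_on {-r..r} a" "continuous_on {-r..r} b" "a 0 > b 0"
    "strands D \<inter> (cball (ctr i) r \<times> UNIV) =
          (\<lambda>t. (ctr i + t *\<^sub>R dir i True, a t)) ` {-r..r} \<union>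
          (\<lambda>t. (ctr i + t *\<^sub>R dir i False, b t :: real)) ` {-r..r}"
    using crossing_facts(4)[OF assms] unfolding crossing_chart_def by auto
  show ?thesis
    by (rule exI[of _ "\<lambda>c. if c then a else b"]) (use ab in \<open>auto simp: UNIV_bool\<close>)
qed

text \<open>The right-hand side is independent of \<open>s\<close>: both smoothings are attached at
  the ends of the two diameters, so all resolutions share one outer part.\<close>

lemma chord_ends_eq:
  "{chord_end i s True True, chord_end i s True False, chord_end i s False True, chord_end i s False False}
   = (\<Union>b. {ctr i - r *\<^sub>R dir i b, ctr i + r *\<^sub>R dir i b})"
  by (cases s) (auto simp: chord_end_def UNIV_bool)

text \<open>The arcs are cut out in space, where over- and understrand are disjoint, and only the
  rest is projected. Since every double point of the diagram is a centre, the projection is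
  injective there.\<close>

lemma outer_one_manifold:
  "one_manifold outer (\<Union>i<n. \<Union>b. {ctr i - r *\<^sub>R dir i b, ctr i + r *\<^sub>R dir i b})"
proof -
  define good where "good i h \<longleftrightarrow> (\<forall>b. continuous_on {-r..r} (h b)) \<and> h True 0 > (h False 0 :: real) \<and>
    strands D \<inter> (cball (ctr i) r \<times> UNIV) = (\<Union>b. (\<lambda>t. (ctr i + t *\<^sub>R dir i b, h b t)) ` {-r..r})" for i h
  have "\<exists>h. i < n \<longrightarrow> good i h" for i
    using strands_in_disk[of i] unfolding good_def by blast
  then obtain h where "\<And>i. i < n \<Longrightarrow> good i (h i)" by metis
  then have h: "\<And>i b. i < n \<Longrightarrow> continuous_on {-r..r} (h i b)"
    "\<And>i. i < n \<Longrightarrow> h i True 0 > h i False 0"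
    "\<And>i. i < n \<Longrightarrow> strands D \<inter> (cball (ctr i) r \<times> UNIV) =
       (\<Union>b. (\<lambda>t. (ctr i + t *\<^sub>R dir i b, h i b t)) ` {-r..r})"
    unfolding good_def by simp_all
  define f where "f = (\<lambda>(i, b) t. (ctr i + t *\<^sub>R dir i b, h i b t))"
  define I where "I = {..<n} \<times> (UNIV :: bool set)"
  have fin: "finite I" by (simp add: I_def)
  have fdist: "dist (ctr (fst j)) (fst (f j t)) = \<bar>t\<bar>" if "j \<in> I" for j t
    using crossing_facts(1) that by (auto simp: f_def I_def dist_norm)
  have M: "one_manifold (strands D) {}"
    using D unfolding annular_diagram_def annular_link_def
    by (intro one_manifold_of_components jordan_circle_homeomorphic) auto
  have sub: "f j ` {-r..r} \<subseteq> strands D" if jI: "j \<in> I" for j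
  proof -
    obtain i b where j: "j = (i, b)" "i < n" using jI by (auto simp: I_def)
    have "f j ` {-r..r} \<subseteq> (\<Union>b. (\<lambda>t. (ctr i + t *\<^sub>R dir i b, h i b t)) ` {-r..r})"
      unfolding f_def j(1) prod.case by (rule UN_upper) simp
    then show ?thesis unfolding h(3)[OF j(2), symmetric] by blast
  qed
  have arc: "arc_between (f j (-r)) (f j r) (f j ` {-r..r})" if j: "j \<in> I" for j
  proof -
    obtain i b where ib: "j = (i, b)" "i < n" using j by (auto simp: I_def)
    have "dir i b \<noteq> 0" using crossing_facts(1)[OF ib(2), of b] by (metis norm_zero zero_neq_one)
    then have "inj_on (f j) {-r..r}"
      unfolding ib(1) f_def prod.case by (intro inj_onI) (simp only: prod.inject add_left_cancel scaleR_cancel_right, blast)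
    moreover have "continuous_on {-r..r} (f j)"
      unfolding ib(1) f_def prod.case by (intro continuous_intros h(1)[OF ib(2)])
    moreover have img: "(\<lambda>t. 2 * r * t - r) ` {0..1} = {-r..r}"
      using radius_pos image_affinity_atLeastAtMost[of "2 * r" "-r" 0 1] by (simp add: field_simps)
    moreover have "inj_on (\<lambda>t. 2 * r * t - r) {0..1}" using radius_pos by (auto simp: inj_on_def)
    ultimately have "arc (f j \<circ> (\<lambda>t. 2 * r * t - r))"
      unfolding arc_def path_def
      by (intro conjI comp_inj_on continuous_on_compose continuous_intros) simp_all
    moreover have "path_image (f j \<circ> (\<lambda>t. 2 * r * t - r)) = f j ` {-r..r}"
      unfolding path_image_def image_comp[symmetric] img ..
    ultimately show ?thesis unfolding arc_between_def
      by (intro exI[of _ "f j \<circ> (\<lambda>t. 2 * r * t - r)"]) (simp add: pathstart_def pathfinish_def)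
  qed
  have disj: "f j ` {-r..r} \<inter> f k ` {-r..r} = {}" if jk: "j \<in> I" "k \<in> I" "j \<noteq> k" for j k
  proof (rule ccontr)
    assume "\<not> ?thesis"
    then obtain z where "z \<in> f j ` {-r..r}" "z \<in> f k ` {-r..r}" by blast
    then obtain t t' where "z = f j t" "t \<in> {-r..r}" "z = f k t'" "t' \<in> {-r..r}" by (elim imageE)
    then have t: "f j t = f k t'" "\<bar>t\<bar> \<le> r" "\<bar>t'\<bar> \<le> r" by auto
    have "fst (f j t) \<in> cball (ctr (fst j)) r" "fst (f j t) \<in> cball (ctr (fst k)) r"
      using fdist[OF jk(1), of t] fdist[OF jk(2), of t'] t by auto
    moreover have "fst j < n" "fst k < n" using jk by (auto simp: I_def)
    ultimately have eq: "fst j = fst k"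
      using crossing_disks_disjoint[of "fst j" "fst k"] by blast
    then have "snd k \<noteq> snd j" using jk(3) by (simp add: prod_eq_iff)
    then have "j = (fst j, snd j)" "k = (fst j, \<not> snd j)" using eq by (auto simp: prod_eq_iff)
    then obtain i where i: "i < n" "j = (i, snd j)" "k = (i, \<not> snd j)"
      using \<open>fst j < n\<close> by blast
    \<comment> \<open>Independence of the directions forces a common point to lie above the centre,
      where the overstrand is strictly higher.\<close>
    have key: False if "f (i, True) t = f (i, False) t'" for t t'
    proof -
      have "t *\<^sub>R dir i True + (- t') *\<^sub>R dir i False = 0" using that by (simp add: f_def)
      then have "t = 0 \<and> - t' = 0" using independent_directions[OF crossing_facts(2)[OF i(1)]] by blast
      then show False using that h(2)[OF i(1)] by (simp add: f_def)
    qed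
    show False
    proof (cases "snd j")
      case True
      then show ?thesis using key[of t t'] t(1) i(2,3) by simp
    next
      case False
      then show ?thesis using key[of t' t] t(1) i(2,3) by simp
    qed
  qed
  let ?X = "strands D - (\<Union>j\<in>I. f j ` {-r..r} - {f j (-r), f j r})"
  have X: "one_manifold ?X (\<Union>j\<in>I. {f j (-r), f j r})"
    using one_manifold_cut_family[OF fin M, of "\<lambda>j. f j (-r)" "\<lambda>j. f j r" "\<lambda>j. f j ` {-r..r}"]
      arc sub disj by simp
  \<comment> \<open>The end points kept by the cuts lie above the bounding circles, so the cuts
    remove exactly what lies above the open disks.\<close>
  have Xeq: "?X = {m \<in> strands D. fst m \<notin> (\<Union>x\<in>set (crossings D). ball (centre x) r)}"
  proof -
    have "m \<in> (\<Union>j\<in>I. f j ` {-r..r} - {f j (-r), f j r}) \<longleftrightarrow>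
      fst m \<in> (\<Union>x\<in>set (crossings D). ball (centre x) r)" if m: "m \<in> strands D" for m
    proof
      assume "m \<in> (\<Union>j\<in>I. f j ` {-r..r} - {f j (-r), f j r})"
      then obtain j t where j: "j \<in> I" "m = f j t" "t \<in> {-r..r}" "m \<noteq> f j (-r)" "m \<noteq> f j r"
        by auto
      then have "\<bar>t\<bar> < r" by (cases "t = r \<or> t = -r") auto
      then have "fst m \<in> ball (ctr (fst j)) r" using fdist[OF j(1)] j(2) by simp
      then show "fst m \<in> (\<Union>x\<in>set (crossings D). ball (centre x) r)"
        using j(1) nth_mem by (auto simp: I_def)
    next
      assume "fst m \<in> (\<Union>x\<in>set (crossings D). ball (centre x) r)"
      then obtain i where i: "i < n" "fst m \<in> ball (ctr i) r" by (auto simp: in_set_conv_nth)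
      then have "m \<in> strands D \<inter> (cball (ctr i) r \<times> UNIV)"
        using m ball_subset_cball by (auto simp: mem_Times_iff)
      then obtain b where "m \<in> (\<lambda>t. (ctr i + t *\<^sub>R dir i b, h i b t)) ` {-r..r}"
        unfolding h(3)[OF i(1)] by (rule UN_E)
      then obtain t where bt: "t \<in> {-r..r}" "m = f (i, b) t"
        unfolding f_def prod.case by (elim imageE)
      have iI: "(i, b) \<in> I" using i by (simp add: I_def)
      have "\<bar>t\<bar> < r" using fdist[OF iI, of t] i(2) bt(2) by simp
      then have "m \<noteq> f (i, b) (-r)" "m \<noteq> f (i, b) r"
        using fdist[OF iI, of t] fdist[OF iI, of r] fdist[OF iI, of "-r"] radius_pos bt(2) by auto
      then show "m \<in> (\<Union>j\<in>I. f j ` {-r..r} - {f j (-r), f j r})" using iI bt by blast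
    qed
    then show ?thesis by (intro set_eqI) (simp only: Diff_iff mem_Collect_eq cong: conj_cong)
  qed
  have "inj_on fst ?X"
  proof (rule inj_onI)
    fix p q assume pq: "p \<in> ?X" "q \<in> ?X" "fst p = fst q"
    show "p = q"
    proof (rule ccontr)
      assume "p \<noteq> q"
      moreover have "\<forall>p\<in>strands D. \<forall>q\<in>strands D. fst p = fst q \<and> p \<noteq> q \<longrightarrow>
          fst p \<in> centre ` set (crossings D)"
        using D unfolding annular_diagram_def by (elim conjE)
      moreover have "p \<in> strands D" "q \<in> strands D" using pq(1,2) by (simp_all only: Diff_iff)
      ultimately have "fst p \<in> centre ` set (crossings D)" using pq(3) by simp
      then have "fst p \<in> (\<Union>x\<in>set (crossings D). ball (centre x) r)" using radius_pos by force
      then show False using pq(1) unfolding Xeq by simp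
    qed
  qed
  from one_manifold_image[OF X _ this]
  have "one_manifold (fst ` ?X) (fst ` (\<Union>j\<in>I. {f j (-r), f j r}))"
    by (simp add: continuous_on_fst)
  moreover have "fst ` ?X = outer" unfolding Xeq by auto
  moreover have "fst ` (\<Union>j\<in>I. {f j (-r), f j r}) =
    (\<Union>i<n. \<Union>b. {ctr i - r *\<^sub>R dir i b, ctr i + r *\<^sub>R dir i b})"
  proof -
    have UN: "(\<Union>j\<in>I. G (fst j) (snd j)) = (\<Union>i<n. \<Union>b. G i b)" for G :: "nat \<Rightarrow> bool \<Rightarrow> complex set"
      by (auto simp: I_def, blast)
    have "fst ` {f j (-r), f j r} = {ctr (fst j) - r *\<^sub>R dir (fst j) (snd j), ctr (fst j) + r *\<^sub>R dir (fst j) (snd j)}" for j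
      by (simp add: f_def split_beta)
    then show ?thesis unfolding image_UN by (simp only: UN[symmetric])
  qed
  ultimately show ?thesis by simp
qed

text \<open>Above the closed disk the link projects to the two diameters, and of these only the end
  points escape the open disk.\<close>

lemma outer_in_disk:
  assumes "i < n" "z \<in> outer" "z \<in> cball (ctr i) r"
  shows "z \<in> (\<Union>b. {ctr i - r *\<^sub>R dir i b, ctr i + r *\<^sub>R dir i b})"
proof -
  obtain m where m: "m \<in> strands D" "fst m = z" using assms(2) by auto
  obtain h where h: "strands D \<inter> (cball (ctr i) r \<times> UNIV) =
      (\<Union>b. (\<lambda>t. (ctr i + t *\<^sub>R dir i b, h b t :: real)) ` {-r..r})"
    using strands_in_disk[OF assms(1)] by blast
  have "m \<in> strands D \<inter> (cball (ctr i) r \<times> UNIV)" using m assms(3) by (auto simp: mem_Times_iff)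
  then obtain b where "m \<in> (\<lambda>t. (ctr i + t *\<^sub>R dir i b, h b t)) ` {-r..r}"
    unfolding h by (rule UN_E)
  then obtain t where bt: "t \<in> {-r..r}" "m = (ctr i + t *\<^sub>R dir i b, h b t)"
    by (elim imageE)
  have "z \<notin> ball (ctr i) r" using assms(1,2) nth_mem by blast
  then have "\<bar>t\<bar> = r" using bt m crossing_facts(1)[OF assms(1), of b] by (auto simp: dist_norm)
  then have "t = r \<or> t = - r" by auto
  moreover have "z = ctr i + t *\<^sub>R dir i b"
    unfolding m(2)[symmetric] bt(2) by (simp only: fst_conv)
  ultimately have "z \<in> {ctr i - r *\<^sub>R dir i b, ctr i + r *\<^sub>R dir i b}"
    by (elim disjE) simp_all
  then show ?thesis by (rule UN_I[OF UNIV_I])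
qed

lemma chord_Int_outer:
  assumes "i < n" shows "chord i s b \<inter> outer = {chord_end i s b True, chord_end i s b False}"
proof (rule antisym)
  show "chord i s b \<inter> outer \<subseteq> {chord_end i s b True, chord_end i s b False}"
  proof
    fix z assume z: "z \<in> chord i s b \<inter> outer"
    then have "z \<notin> ball (ctr i) r" using assms nth_mem by blast
    then show "z \<in> {chord_end i s b True, chord_end i s b False}"
      using z chord_Int_sphere[OF chord_end_dist[OF assms] chord_end_dist[OF assms]]
      unfolding chord_def by auto
  qed
  have "chord_end i s b e \<in> outer" for e
  proof -
    have "chord_end i s b e \<in> (\<Union>b. {ctr i - r *\<^sub>R dir i b, ctr i + r *\<^sub>R dir i b})"
      unfolding chord_ends_eq[of i s, symmetric] by (cases b; cases e) auto
    then show ?thesis using one_manifold_boundary[OF outer_one_manifold] assms by blast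
  qed
  then show "{chord_end i s b True, chord_end i s b False} \<subseteq> chord i s b \<inter> outer"
    by (auto simp: chord_def)
qed

section \<open>Resolutions as closed 1-manifolds\<close>

lemma resolution_chords:
  "resolution D u = outer \<union> (\<Union>i<n. \<Union>b. chord i (u ! i) b)"
  unfolding resolution_def smoothing_chords by (auto simp: UNIV_bool)

text \<open>The ends of the chords are precisely the boundary points of the outer part, so gluing in
  all chords, two for each crossing, leaves no boundary.\<close>

lemma resolution_one_manifold: "one_manifold (resolution D u) {}"
proof -
  define I where "I = {..<n} \<times> (UNIV :: bool set)"
  let ?E = "\<Union>i<n. \<Union>b. {ctr i - r *\<^sub>R dir i b, ctr i + r *\<^sub>R dir i b}"
  define p where "p = (\<lambda>e (i, b). chord_end i (u ! i) b e)"
  define a where "a = (\<lambda>(i, b). chord i (u ! i) b)"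
  have E: "?E = (\<Union>j\<in>I. {p True j, p False j})"
  proof -
    have "(\<Union>b. {ctr i - r *\<^sub>R dir i b, ctr i + r *\<^sub>R dir i b}) = (\<Union>b. {p True (i, b), p False (i, b)})" for i
      unfolding chord_ends_eq[of i "u ! i", symmetric] by (auto simp: p_def UNIV_bool)
    then show ?thesis by (auto simp: I_def)
  qed
  have "one_manifold (outer \<union> (\<Union>j\<in>I. a j)) (?E - (\<Union>j\<in>I. {p True j, p False j}))"
  proof (rule one_manifold_glue_family[OF _ outer_one_manifold])
    show "finite I" by (simp add: I_def)
    show "arc_between (p True j) (p False j) (a j) \<and> a j \<inter> outer = {p True j, p False j} \<and>
       {p True j, p False j} \<subseteq> ?E" if jI: "j \<in> I" for j
    proof (intro conjI)
      obtain i b where j: "j = (i, b)" "i < n" using jI by (auto simp: I_def)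
      show "arc_between (p True j) (p False j) (a j)"
        unfolding j(1) p_def a_def prod.case by (rule chord_arc[OF j(2)])
      show "a j \<inter> outer = {p True j, p False j}"
        unfolding j(1) p_def a_def prod.case by (rule chord_Int_outer[OF j(2)])
      show "{p True j, p False j} \<subseteq> ?E" unfolding E using jI by (rule UN_upper)
    qed
    show "a j \<inter> a k = {}" if jk: "j \<in> I" "k \<in> I" "j \<noteq> k" for j k
    proof (cases "fst j = fst k")
      case True
      then have "snd j \<noteq> snd k" using jk(3) by (simp add: prod_eq_iff)
      then have "snd k = (\<not> snd j)" by auto
      moreover have "fst j < n" using jk(1) by (auto simp: I_def)
      ultimately show ?thesis using True chords_disjoint[of "fst j" "u ! fst j"]
        unfolding a_def split_beta by (cases "snd j") (simp_all add: Int_commute)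
    next
      case False
      have n: "fst j < n" "fst k < n" using jk by (auto simp: I_def)
      show ?thesis
        using chord_in_disk[OF n(1)] chord_in_disk[OF n(2)] crossing_disks_disjoint[OF n False]
        unfolding a_def split_beta by blast
    qed
  qed
  moreover have "(\<Union>j\<in>I. a j) = (\<Union>i<n. \<Union>b. chord i (u ! i) b)"
    by (auto simp: I_def a_def)
  ultimately show ?thesis unfolding E resolution_chords by simp
qed

lemma circles_jordan:
  "finite (circles D u)" "C \<in> circles D u \<Longrightarrow> jordan_circle C"
  using one_manifold_components[OF resolution_one_manifold] unfolding circles_def by auto

lemma resolution_in_disk:
  assumes "i < n" shows "resolution D u \<inter> cball (ctr i) r = chord i (u ! i) True \<union> chord i (u ! i) False"
proof (rule antisym)
  show "chord i (u ! i) True \<union> chord i (u ! i) False \<subseteq> resolution D u \<inter> cball (ctr i) r"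
    using chord_in_disk[OF assms] assms unfolding resolution_chords by blast
  show "resolution D u \<inter> cball (ctr i) r \<subseteq> chord i (u ! i) True \<union> chord i (u ! i) False"
  proof
    fix z assume z: "z \<in> resolution D u \<inter> cball (ctr i) r"
    then consider "z \<in> outer" | j b where "j < n" "z \<in> chord j (u ! j) b"
      unfolding resolution_chords by blast
    then show "z \<in> chord i (u ! i) True \<union> chord i (u ! i) False"
    proof cases
      case 1
      then have "z \<in> (\<Union>b. {ctr i - r *\<^sub>R dir i b, ctr i + r *\<^sub>R dir i b})"
        using outer_in_disk[OF assms] z by blast
      then show ?thesis unfolding chord_ends_eq[of i "u ! i", symmetric] by (auto simp: chord_def)
    next
      case (2 j b)
      then have "j = i" using chord_in_disk[of j] crossing_disks_disjoint[of j i] assms z by blast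
      then show ?thesis using 2 by (cases b) auto
    qed
  qed
qed

lemma resolution_subset_annulus: "resolution D u \<subseteq> annulus"
proof -
  have "fst ` strands D \<subseteq> annulus"
    using D by (auto simp: annular_diagram_def annular_link_def thick_annulus_def)
  then show ?thesis unfolding resolution_chords
    using chord_in_disk crossing_facts(3) by blast
qed

section \<open>Changing one smoothing\<close>

lemma resolution_off_disk:
  assumes "\<And>j. j < n \<Longrightarrow> j \<noteq> i \<Longrightarrow> u ! j = v ! j"
  shows "resolution D u - cball (ctr i) r \<subseteq> resolution D v"
proof
  fix z assume z: "z \<in> resolution D u - cball (ctr i) r"
  then consider "z \<in> outer" | j b where "j < n" "z \<in> chord j (u ! j) b"
    unfolding resolution_chords by blast
  then show "z \<in> resolution D v"
  proof cases
    case (2 j b)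
    then have "j \<noteq> i" using chord_in_disk[of i] z by blast
    then show ?thesis using 2 assms unfolding resolution_chords by fastforce
  qed (auto simp: resolution_chords)
qed

text \<open>A circle meeting the disk contains a whole chord, by connectedness, and the midpoint of
  this chord is missing from the other resolution. A circle avoiding the disk survives as a set and
  stays separated from everything else.\<close>

lemma circle_of_changed_resolution:
  assumes i: "i < n" and uv: "\<And>j. j < n \<Longrightarrow> j \<noteq> i \<Longrightarrow> u ! j = v ! j" "u ! i \<noteq> v ! i"
    and C: "C \<in> circles D u"
  shows "C \<in> circles D v \<longleftrightarrow> C \<inter> cball (ctr i) r = {}"
proof
  let ?Ru = "resolution D u" and ?Rv = "resolution D v"
  have Cu: "C \<in> components ?Ru" using C by (simp add: circles_def)
  show "C \<inter> cball (ctr i) r = {}" if "C \<in> circles D v"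
  proof (rule ccontr)
    assume "C \<inter> cball (ctr i) r \<noteq> {}"
    then have "C \<inter> (chord i (u ! i) True \<union> chord i (u ! i) False) \<noteq> {}"
      using resolution_in_disk[OF i, of u] in_components_subset[OF Cu] by blast
    then obtain b where b: "C \<inter> chord i (u ! i) b \<noteq> {}" by blast
    have "chord i (u ! i) b \<subseteq> C"
      by (rule components_maximal[OF Cu])
        (use b i in \<open>auto simp: chord_def resolution_chords\<close>)
    moreover have "midpoint (chord_end i (u ! i) b True) (chord_end i (u ! i) b False)
        \<in> chord i (u ! i) b" (is "?z \<in> _") by (simp add: chord_def)
    moreover have "C \<subseteq> ?Rv" using that by (simp add: circles_def in_components_subset)
    ultimately have "?z \<in> ?Rv \<inter> cball (ctr i) r" using chord_in_disk[OF i] by blast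
    then have "?z \<in> chord i (v ! i) True \<union> chord i (v ! i) False"
      unfolding resolution_in_disk[OF i] .
    then show False using chord_midpoint_notin[OF i uv(2)] by blast
  qed
  show "C \<in> circles D v" if disj: "C \<inter> cball (ctr i) r = {}"
  proof -
    \<comment> \<open>\<open>?Y\<close> is closed because there are finitely many circles; it is
      disjoint from \<open>C\<close>, and together with \<open>C\<close> it covers
      \<open>?Rv\<close>. A component of \<open>?Rv\<close> containing \<open>C\<close> can thus not
      extend beyond \<open>C\<close>.\<close>
    let ?Y = "\<Union>(components ?Ru - {C}) \<union> cball (ctr i) r"
    have "closed ?Y"
    proof (intro closed_Un closed_Union closed_cball ballI)
      show "finite (components ?Ru - {C})" using circles_jordan(1)[of u] by (simp add: circles_def)
      show "closed K" if "K \<in> components ?Ru - {C}" for K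
        using closed_components[OF one_manifold_closed[OF resolution_one_manifold]] that by auto
    qed
    have CY: "C \<inter> ?Y = {}" using disj components_nonoverlap[OF Cu] by auto
    have Cne: "C \<noteq> {}" "connected C" using jordan_circle_facts[OF circles_jordan(2)[OF C]] by auto
    have "C \<subseteq> ?Rv" using resolution_off_disk[of i u v, OF uv(1)] in_components_subset[OF Cu] disj by blast
    then obtain K where K: "K \<in> components ?Rv" "C \<subseteq> K"
      using exists_component_superset[of C ?Rv] Cne by blast
    have "?Rv - cball (ctr i) r \<subseteq> ?Ru" by (rule resolution_off_disk) (use uv(1) in simp)
    then have "K \<subseteq> C \<union> ?Y"
      using in_components_subset[OF K(1)] in_components_unions_complement[OF Cu] by blast
    then have "K \<subseteq> C \<or> K \<subseteq> ?Y"
      using connected_subset_closed_Un[OF in_components_connected[OF K(1)], of C ?Y] CY \<open>closed ?Y\<close>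
        jordan_circle_facts(1)[OF circles_jordan(2)[OF C]] by blast
    then have "K = C" using K(2) CY Cne by blast
    then show ?thesis using K by (simp add: circles_def)
  qed
qed

end

section \<open>Nesting of nontrivial circles\<close>

text \<open>The point 0 is the centre of the hole of the annulus.\<close>

definition core :: "complex set \<Rightarrow> complex set" where
  "core C = connected_component_set (- C) 0"

lemma core_facts:
  assumes "closed C" "0 \<notin> C"
  shows "open (core C)" "0 \<in> core C" "core C \<inter> C = {}" "connected (core C)" "frontier (core C) \<subseteq> C"
proof -
  have "open (- C)" using assms(1) by (simp add: open_Compl)
  then show op: "open (core C)" unfolding core_def by (rule open_connected_component)
  show "0 \<in> core C" using assms(2) by (simp add: core_def)
  show "core C \<inter> C = {}" using connected_component_subset[of "- C" 0] by (auto simp: core_def)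
  show "connected (core C)" by (simp add: core_def)
  have "core C \<in> components (- C)" unfolding core_def using assms(2) by (intro componentsI) simp
  then show "frontier (core C) \<subseteq> C"
    using frontier_of_components_closed_complement[OF assms(1)] by blast
qed

lemma core_maximal:
  assumes "connected W" "W \<inter> C = {}" "W \<inter> core C \<noteq> {}" shows "W \<subseteq> core C"
proof -
  obtain w where w: "w \<in> W" "connected_component (- C) 0 w" using assms(3) by (auto simp: core_def)
  have "W \<subseteq> connected_component_set (- C) w"
    by (rule connected_component_maximal) (use assms(1,2) w(1) in auto)
  then show ?thesis unfolding core_def using connected_component_eq[of w "- C" 0] w(2) by simp
qed

text \<open>The source of the contradictions below: such a set is also closed, while the plane is
  connected and unbounded.\<close>

lemma bounded_clopen_trivial:
  fixes S :: "complex set"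
  assumes "open S" "bounded S" "frontier S \<subseteq> S" shows "S = {}"
proof -
  have "closed S" using assms(3) frontier_subset_eq by blast
  then have "S = {} \<or> S = UNIV" using assms(1) clopen by blast
  then show ?thesis using assms(2) not_bounded_UNIV by blast
qed

text \<open>If each curve lay in the core of the other, the union of the cores would contain its own
  frontier. If neither did, each core would avoid the other curve, so the cores would coincide and
  their frontier would lie in the empty intersection of the curves. Bounded cores admit
  neither.\<close>

lemma nested_or_nested:
  assumes C: "closed C" "connected C" "C \<noteq> {}" "0 \<notin> C" "bounded (core C)"
    and C': "closed C'" "connected C'" "C' \<noteq> {}" "0 \<notin> C'" "bounded (core C')"
    and disj: "C \<inter> C' = {}"
  shows "C \<subseteq> core C' \<longleftrightarrow> \<not> C' \<subseteq> core C"
proof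
  note f = core_facts[OF C(1,4)] and f' = core_facts[OF C'(1,4)]
  show "\<not> C' \<subseteq> core C" if 1: "C \<subseteq> core C'"
  proof
    assume 2: "C' \<subseteq> core C"
    have "frontier (core C \<union> core C') \<subseteq> core C \<union> core C'"
      using frontier_Un_subset[of "core C" "core C'"] f(5) f'(5) 1 2 by blast
    then have "core C \<union> core C' = {}"
      using f(1) f'(1) C(5) C'(5) by (intro bounded_clopen_trivial) auto
    then show False using f by auto
  qed
  show "C \<subseteq> core C'" if 1: "\<not> C' \<subseteq> core C"
  proof (rule ccontr)
    assume 2: "\<not> C \<subseteq> core C'"
    have "C' \<inter> core C = {}" using core_maximal[OF C'(2)] disj 1 by blast
    then have s1: "core C \<subseteq> core C'" using core_maximal[OF f(4)] f(2) f'(2) by blast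
    have "C \<inter> core C' = {}" using core_maximal[OF C(2)] disj 2 by blast
    then have s2: "core C' \<subseteq> core C" using core_maximal[OF f'(4)] f(2) f'(2) by blast
    have "frontier (core C) \<subseteq> C \<inter> C'" using s1 s2 f(5) f'(5) by auto
    then have "core C = {}" using disj f C by (intro bounded_clopen_trivial) auto
    then show False using f by auto
  qed
qed

text \<open>
  If the component of 0 in the complement of the curve is unbounded, the inside of the
  curve meets neither boundary disk of the annulus, so it is a disk in the annulus.
\<close>

lemma bounded_core_nontrivial:
  assumes C: "jordan_circle C" "C \<subseteq> annulus" "\<not> trivial_circle C"
  shows "bounded (core C)"
proof (rule ccontr)
  assume ub: "\<not> bounded (core C)"
  obtain g where g: "simple_path g" "pathfinish g = pathstart g" "path_image g = C"
    using C(1) unfolding jordan_circle_def by blast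
  note J = Jordan_inside_outside[OF g(1,2), unfolded g(3)]
  have z: "0 \<notin> C" using C(2) by (auto simp: annulus_def)
  have in0: "inside C \<inter> core C = {}"
  proof -
    have "z \<notin> inside C" if "z \<in> core C" for z
    proof -
      have "connected_component_set (- C) z = core C"
        using that unfolding core_def by (metis connected_component_eq mem_Collect_eq)
      then show ?thesis using ub by (simp add: inside_def)
    qed
    then show ?thesis by blast
  qed
  have "ball 0 1 \<subseteq> core C"
  proof (rule core_maximal)
    show "ball 0 1 \<inter> C = {}" using C(2) by (auto simp: annulus_def)
    show "ball 0 1 \<inter> core C \<noteq> {}"
      using core_facts(2)[OF jordan_circle_facts(1)[OF C(1)] z] by (metis IntI centre_in_ball empty_iff zero_less_one)
  qed simp
  moreover have "- cball 0 2 \<subseteq> outside C"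
  proof -
    have "outside (cball (0::complex) 2) \<subseteq> outside C"
      by (rule outside_mono) (use C(2) in \<open>auto simp: annulus_def\<close>)
    then show ?thesis by (simp add: outside_convex)
  qed
  ultimately have "z \<notin> ball 0 1 \<and> z \<in> cball 0 2" if "z \<in> inside C" for z
    using in0 inside_Int_outside[of C] that by blast
  then have "inside C \<subseteq> annulus" by (auto simp: annulus_def not_less)
  \<comment> \<open>The inside of a Jordan curve is simply connected, hence homeomorphic to a disk
    by the Riemann mapping theorem.\<close>
  moreover have "inside C homeomorphic ball (0::complex) 1"
    using simply_connected_inside_simple_path[OF g(1)] g(3) J
      simply_connected_eq_homeomorphic_to_disc[of "inside C"] by simp
  ultimately have "trivial_circle C" unfolding trivial_circle_def using J by blast
  then show False using C(3) by simp
qed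

context annular_resolutions begin

definition essential :: "bool list \<Rightarrow> complex set set" where
  "essential u = {C \<in> circles D u. \<not> trivial_circle C}"

text \<open>Depth is counted from the hole outwards. The circle \<open>C\<close> does not count
  itself, since it is disjoint from its core.\<close>

definition nesting_sign :: "bool list \<Rightarrow> complex set \<Rightarrow> complex" where
  "nesting_sign u C = (- 1) ^ card {C' \<in> essential u. C' \<subseteq> core C}"

lemma essential_facts:
  assumes "C \<in> essential u"
  shows "closed C" "connected C" "C \<noteq> {}" "0 \<notin> C" "bounded (core C)" "\<not> C \<subseteq> core C"
proof -
  have C: "C \<in> circles D u" "jordan_circle C" "\<not> trivial_circle C"
    using assms circles_jordan(2) by (auto simp: essential_def)
  have "C \<subseteq> annulus" using C(1) resolution_subset_annulus in_components_subset
    unfolding circles_def by blast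
  then show "bounded (core C)" "0 \<notin> C" using C bounded_core_nontrivial by (auto simp: annulus_def)
  show "closed C" "connected C" "C \<noteq> {}" using jordan_circle_facts[OF C(2)] by auto
  then show "\<not> C \<subseteq> core C" using core_facts(3)[OF \<open>closed C\<close> \<open>0 \<notin> C\<close>] by blast
qed

lemma essential_nested:
  assumes "C \<in> essential u" "C' \<in> essential u" "C \<noteq> C'"
  shows "C \<subseteq> core C' \<longleftrightarrow> \<not> C' \<subseteq> core C"
proof -
  have "C \<inter> C' = {}"
    using assms components_nonoverlap[of C "resolution D u" C'] by (simp add: essential_def circles_def)
  then show ?thesis
    using nested_or_nested[OF essential_facts(1-5)[OF assms(1)] essential_facts(1-5)[OF assms(2)]] by simp
qed

lemma finite_essential: "finite (essential u)"
  using circles_jordan(1) by (simp add: essential_def)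

section \<open>Nesting signs across an edge of the cube\<close>

context
  fixes i :: nat and u v :: "bool list"
  assumes i: "i < n" and uv: "\<And>j. j < n \<Longrightarrow> j \<noteq> i \<Longrightarrow> u ! j = v ! j" "u ! i \<noteq> v ! i"
begin

lemma changed_circle_meets_disk:
  assumes "C \<in> (circles D u - circles D v) \<union> (circles D v - circles D u)"
  shows "C \<inter> cball (ctr i) r \<noteq> {}"
  using assms circle_of_changed_resolution[OF i, of u v C] circle_of_changed_resolution[OF i, of v u C] uv
  by auto

text \<open>The changed circles are joined by the disk of the changed crossing.\<close>

lemma changed_circles_connected:
  assumes "C \<in> circles D u \<inter> circles D v"
    and N: "N \<in> (circles D u - circles D v) \<union> (circles D v - circles D u)"
    and N': "N' \<in> (circles D u - circles D v) \<union> (circles D v - circles D u)"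
  shows "\<exists>W. connected W \<and> N \<subseteq> W \<and> N' \<subseteq> W \<and> W \<inter> C = {}"
proof (intro exI conjI)
  have con: "connected M" if "M \<in> (circles D u - circles D v) \<union> (circles D v - circles D u)" for M
    using that in_components_connected by (auto simp: circles_def)
  have "connected (N \<union> cball (ctr i) r)"
    by (rule connected_Un) (use con[OF N] changed_circle_meets_disk[OF N] in auto)
  then show "connected (N \<union> cball (ctr i) r \<union> N')"
    by (rule connected_Un) (use con[OF N'] changed_circle_meets_disk[OF N'] in auto)
  have "M \<inter> C = {}" if "M \<in> (circles D u - circles D v) \<union> (circles D v - circles D u)" for M
    using that assms(1) components_nonoverlap by (auto simp: circles_def)
  moreover have "C \<inter> cball (ctr i) r = {}"
    using circle_of_changed_resolution[OF i, of u v C] uv assms(1) by auto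
  ultimately show "(N \<union> cball (ctr i) r \<union> N') \<inter> C = {}" using N N' by blast
qed auto

text \<open>A connected set that contains both circles and avoids \<open>C\<close> lies in the core
  of \<open>C\<close> as soon as it meets it.\<close>

lemma changed_inside_common:
  assumes "C \<in> circles D u \<inter> circles D v"
    and N: "N \<in> (circles D u - circles D v) \<union> (circles D v - circles D u)"
    and N': "N' \<in> (circles D u - circles D v) \<union> (circles D v - circles D u)"
  shows "N \<subseteq> core C \<longleftrightarrow> N' \<subseteq> core C"
proof -
  obtain W where W: "connected W" "N \<subseteq> W" "N' \<subseteq> W" "W \<inter> C = {}"
    using changed_circles_connected[OF assms] by blast
  have "N \<noteq> {}" "N' \<noteq> {}" using N N' in_components_nonempty by (auto simp: circles_def)
  then show ?thesis using core_maximal[OF W(1,4)] W(2,3) by blast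
qed

text \<open>Of two nontrivial circles exactly one encloses the other, so both sides are negations of
  the inclusions compared in \<open>changed_inside_common\<close>.\<close>

lemma common_inside_changed:
  assumes C: "C \<in> essential u \<inter> essential v"
    and N: "N \<in> (essential u - essential v) \<union> (essential v - essential u)"
    and N': "N' \<in> (essential u - essential v) \<union> (essential v - essential u)"
  shows "C \<subseteq> core N \<longleftrightarrow> C \<subseteq> core N'"
proof -
  have "C \<subseteq> core M \<longleftrightarrow> \<not> M \<subseteq> core C"
    if "M \<in> (essential u - essential v) \<union> (essential v - essential u)" for M
    using that essential_nested[of C u M] essential_nested[of C v M] C by blast
  moreover have "N \<subseteq> core C \<longleftrightarrow> N' \<subseteq> core C"
    by (rule changed_inside_common) (use C N N' in \<open>auto simp: essential_def\<close>)
  ultimately show ?thesis using N N' by blast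
qed

lemma nesting_sign_split:
  "nesting_sign w C = (- 1) ^ card {C' \<in> essential u \<inter> essential v. C' \<subseteq> core C} *
     (- 1) ^ card {C' \<in> essential w - essential u \<inter> essential v. C' \<subseteq> core C}"
  if "w = u \<or> w = v"
proof -
  have "{C' \<in> essential w. C' \<subseteq> core C} = {C' \<in> essential u \<inter> essential v. C' \<subseteq> core C} \<union>
      {C' \<in> essential w - essential u \<inter> essential v. C' \<subseteq> core C}" using that by auto
  then have "card {C' \<in> essential w. C' \<subseteq> core C} = card {C' \<in> essential u \<inter> essential v. C' \<subseteq> core C} +
      card {C' \<in> essential w - essential u \<inter> essential v. C' \<subseteq> core C}"
    using finite_essential by (simp add: card_Un_disjoint disjoint_iff)
  then show ?thesis by (simp add: nesting_sign_def power_add)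
qed

text \<open>\<open>N\<close> and \<open>N'\<close> enclose the same persisting circles, and exactly
  one of them encloses the other: their depths differ by one. A persisting circle encloses both or
  neither, so the loss of the pair lowers its depth by 2 or 0.\<close>

lemma nesting_sign_two:
  assumes uN: "essential u - essential v = {N, N'}" "N \<noteq> N'" and vN: "essential v - essential u = {}"
  shows "nesting_sign u N = - nesting_sign u N'"
    and "C \<in> essential u \<inter> essential v \<Longrightarrow> nesting_sign u C = nesting_sign v C"
proof -
  have e: "essential u - essential u \<inter> essential v = {N, N'}"
    "essential v - essential u \<inter> essential v = {}" using uN vN by auto
  have N: "N \<in> essential u" "N' \<in> essential u" using uN(1) by auto
  have "{C' \<in> essential u \<inter> essential v. C' \<subseteq> core N} = {C' \<in> essential u \<inter> essential v. C' \<subseteq> core N'}"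
    using common_inside_changed[of _ N N'] uN(1) by auto
  moreover have "{C' \<in> {N, N'}. C' \<subseteq> core N} = (if N' \<subseteq> core N then {N'} else {})"
    "{C' \<in> {N, N'}. C' \<subseteq> core N'} = (if N' \<subseteq> core N then {} else {N})"
    using essential_facts(6)[OF N(1)] essential_facts(6)[OF N(2)] essential_nested[OF N uN(2)] by auto
  ultimately show "nesting_sign u N = - nesting_sign u N'"
    using nesting_sign_split[of u N] nesting_sign_split[of u N'] unfolding e by simp
  show "nesting_sign u C = nesting_sign v C" if C: "C \<in> essential u \<inter> essential v"
  proof -
    have "N \<subseteq> core C \<longleftrightarrow> N' \<subseteq> core C"
      by (rule changed_inside_common) (use C uN(1) in \<open>auto simp: essential_def\<close>)
    then have "{C' \<in> {N, N'}. C' \<subseteq> core C} = (if N \<subseteq> core C then {N, N'} else {})" by auto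
    then show ?thesis
      using nesting_sign_split[of u C] nesting_sign_split[of v C] uN(2) unfolding e by simp
  qed
qed

text \<open>\<open>N'\<close> takes the place of \<open>N\<close> in every count: the two enclose
  the same persisting circles and are enclosed by the same ones.\<close>

lemma nesting_sign_one:
  assumes uN: "essential u - essential v = {N}" and vN: "essential v - essential u = {N'}"
  shows "nesting_sign u N = nesting_sign v N'"
    and "C \<in> essential u \<inter> essential v \<Longrightarrow> nesting_sign u C = nesting_sign v C"
proof -
  have e: "essential u - essential u \<inter> essential v = {N}"
    "essential v - essential u \<inter> essential v = {N'}" using uN vN by auto
  have N: "N \<in> essential u" "N' \<in> essential v" using uN vN by auto
  have "{C' \<in> essential u \<inter> essential v. C' \<subseteq> core N} = {C' \<in> essential u \<inter> essential v. C' \<subseteq> core N'}"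
    using common_inside_changed[of _ N N'] uN vN by auto
  moreover have "{C' \<in> {N}. C' \<subseteq> core N} = {}" "{C' \<in> {N'}. C' \<subseteq> core N'} = {}"
    using essential_facts(6)[OF N(1)] essential_facts(6)[OF N(2)] by auto
  ultimately show "nesting_sign u N = nesting_sign v N'"
    using nesting_sign_split[of u N] nesting_sign_split[of v N'] unfolding e by (simp only: simp_thms)
  show "nesting_sign u C = nesting_sign v C" if C: "C \<in> essential u \<inter> essential v"
  proof -
    have "N \<subseteq> core C \<longleftrightarrow> N' \<subseteq> core C"
      by (rule changed_inside_common) (use C uN vN in \<open>auto simp: essential_def\<close>)
    then have "card {C' \<in> {N}. C' \<subseteq> core C} = card {C' \<in> {N'}. C' \<subseteq> core C}"
      by (cases "N \<subseteq> core C") (auto simp: Collect_conv_if)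
    then show ?thesis
      using nesting_sign_split[of u C] nesting_sign_split[of v C] unfolding e by (simp only: simp_thms)
  qed
qed

end

end

section \<open>The action of the raising and lowering operators\<close>

fun other :: "label \<Rightarrow> label" where
  "other Plus = Minus"
| "other Minus = Plus"

lemma other_simps [simp]: "other (other l) = l" "other l \<noteq> l" "l \<noteq> other l"
  by (cases l; simp)+

definition label_weight :: "label \<Rightarrow> int" where
  "label_weight l = (case l of Plus \<Rightarrow> 1 | Minus \<Rightarrow> -1)"

definition circle_weight :: "complex set \<Rightarrow> label \<Rightarrow> int" where
  "circle_weight C l = (if trivial_circle C then 0 else label_weight l)"

context annular_resolutions begin

lemma nesting_sign_square [simp]: "nesting_sign u C * nesting_sign u C = 1"
  by (simp add: nesting_sign_def flip: power_mult_distrib)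

lemma k_grading_eq: "k_grading D (u, \<sigma>) = (\<Sum>C\<in>circles D u. circle_weight C (\<sigma> C))"
  unfolding k_grading_def circle_weight_def label_weight_def by simp

lemma k_grading_essential: "k_grading D (u, \<sigma>) = (\<Sum>C\<in>essential u. label_weight (\<sigma> C))"
proof -
  have "k_grading D (u, \<sigma>) = (\<Sum>C\<in>circles D u. if \<not> trivial_circle C then label_weight (\<sigma> C) else 0)"
    unfolding k_grading_eq by (rule sum.cong) (simp_all add: circle_weight_def)
  also have "\<dots> = (\<Sum>C\<in>essential u. label_weight (\<sigma> C))"
    using circles_jordan(1)[of u] by (simp add: essential_def sum.inter_filter)
  finally show ?thesis .
qed

lemma finite_states: "finite (states D)"
proof -
  have "finite {u :: bool list. length u = n}"
    using finite_lists_length_eq[of "UNIV :: bool set" n] by simp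
  moreover have "finite (UNIV :: label set)"
  proof -
    have "UNIV = {Plus, Minus}" using label.exhaust by auto
    then show ?thesis by (metis finite.emptyI finite.insertI)
  qed
  then have "finite (circles D u \<rightarrow>\<^sub>E (UNIV :: label set))" for u
    using circles_jordan(1) by (intro finite_PiE) auto
  moreover have "states D = Sigma {u. length u = n} (\<lambda>u. circles D u \<rightarrow>\<^sub>E UNIV)"
    by (auto simp: states_def)
  ultimately show ?thesis by (metis finite_SigmaI)
qed

lemma states_upd: "C \<in> circles D u \<Longrightarrow> (u, \<tau>(C := l)) \<in> states D \<longleftrightarrow> (u, \<tau>) \<in> states D"
  by (auto simp: states_def PiE_iff extensional_def)

text \<open>\<open>shift Plus\<close> and \<open>shift Minus\<close> are the raising and lowering operators of \<open>sl\<^sub>2\<close>.\<close>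

definition shift :: "label \<Rightarrow> (state \<Rightarrow> complex) \<Rightarrow> state \<Rightarrow> complex" where
  "shift l \<psi> = (\<lambda>(u, \<tau>). \<Sum>C | C \<in> essential u \<and> \<tau> C = l. nesting_sign u C * \<psi> (u, \<tau>(C := other l)))"

definition flip :: "(state \<Rightarrow> complex) \<Rightarrow> state \<Rightarrow> complex" where
  "flip \<psi> = (\<lambda>(u, \<tau>). \<psi> (u, \<lambda>C. if C \<in> essential u then other (\<tau> C) else \<tau> C))"

lemma k_grading_upd:
  assumes "C \<in> essential u" "\<tau> C = l"
  shows "k_grading D (u, \<tau>) = k_grading D (u, \<tau>(C := other l)) + 2 * label_weight l"
proof -
  have "(\<Sum>C'\<in>essential u - {C}. label_weight ((\<tau>(C := other l)) C')) =
      (\<Sum>C'\<in>essential u - {C}. label_weight (\<tau> C'))"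
    by (rule sum.cong) auto
  moreover have "label_weight (other l) = - label_weight l" by (cases l) (simp_all add: label_weight_def)
  ultimately show ?thesis
    unfolding k_grading_essential sum.remove[OF finite_essential assms(1)] using assms(2) by simp
qed

lemma shift_CKh:
  assumes "\<psi> \<in> CKh D k" shows "shift l \<psi> \<in> CKh D (k + 2 * label_weight l)"
  unfolding CKh_def
proof (clarsimp, intro conjI)
  fix u \<tau> assume "shift l \<psi> (u, \<tau>) \<noteq> 0"
  then have "(\<Sum>C | C \<in> essential u \<and> \<tau> C = l. nesting_sign u C * \<psi> (u, \<tau>(C := other l))) \<noteq> 0"
    by (simp add: shift_def)
  then obtain C where C: "C \<in> essential u" "\<tau> C = l" "\<psi> (u, \<tau>(C := other l)) \<noteq> 0"
    by (rule sum.not_neutral_contains_not_neutral) auto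
  then have "(u, \<tau>(C := other l)) \<in> states D" "k_grading D (u, \<tau>(C := other l)) = k"
    using assms by (auto simp: CKh_def)
  then show "(u, \<tau>) \<in> states D" "k_grading D (u, \<tau>) = k + 2 * label_weight l"
    using states_upd[of C u \<tau>] k_grading_upd[of C u \<tau> l] C(1,2) by (auto simp: essential_def)
qed

text \<open>Relabelling two different circles gives the same terms \<open>X C C'\<close> in both
  orders, and they cancel. Relabelling one circle twice restores \<open>S\<close> with squared sign
  1, once for every \<open>Plus\<close> in one order and for every \<open>Minus\<close> in the
  other; the difference of these numbers is the weight.\<close>

lemma shift_commutator:
  "shift Plus (shift Minus \<psi>) S - shift Minus (shift Plus \<psi>) S = of_int (k_grading D S) * \<psi> S"
proof -
  obtain u \<tau> where S: "S = (u, \<tau>)" by force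
  define P where "P = {C \<in> essential u. \<tau> C = Plus}"
  define M where "M = {C \<in> essential u. \<tau> C = Minus}"
  have fin: "finite P" "finite M" using finite_essential by (auto simp: P_def M_def)
  define X where "X C C' = nesting_sign u C * nesting_sign u C' * \<psi> (u, \<tau>(C := Minus, C' := Plus))" for C C'
  have sq: "nesting_sign u C * (nesting_sign u C * x) = x" for C x
    by (simp flip: mult.assoc)
  have pm: "shift Plus (shift Minus \<psi>) S = (\<Sum>C\<in>P. \<psi> S + (\<Sum>C'\<in>M. X C C'))"
    unfolding S shift_def prod.case P_def[symmetric]
  proof (rule sum.cong[OF refl])
    fix C assume C: "C \<in> P"
    then have "{C'. C' \<in> essential u \<and> (\<tau>(C := other Plus)) C' = Minus} = insert C M"
      by (auto simp: P_def M_def)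
    moreover have "C \<notin> M" using C by (auto simp: P_def M_def)
    moreover have "\<tau>(C := Plus) = \<tau>" using C by (auto simp: P_def)
    ultimately show "nesting_sign u C * (\<Sum>C' | C' \<in> essential u \<and> (\<tau>(C := other Plus)) C' = Minus.
        nesting_sign u C' * \<psi> (u, \<tau>(C := other Plus, C' := other Minus))) = \<psi> (u, \<tau>) + (\<Sum>C'\<in>M. X C C')"
      using fin by (simp add: algebra_simps sum_distrib_left X_def sq)
  qed
  have mp: "shift Minus (shift Plus \<psi>) S = (\<Sum>C'\<in>M. \<psi> S + (\<Sum>C\<in>P. X C C'))"
    unfolding S shift_def prod.case M_def[symmetric]
  proof (rule sum.cong[OF refl])
    fix C' assume C': "C' \<in> M"
    then have "{C. C \<in> essential u \<and> (\<tau>(C' := other Minus)) C = Plus} = insert C' P"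
      by (auto simp: P_def M_def)
    moreover have C'P: "C' \<notin> P" using C' by (auto simp: P_def M_def)
    moreover have "\<tau>(C' := Minus) = \<tau>" using C' by (auto simp: M_def)
    moreover have "(\<Sum>C\<in>P. nesting_sign u C' * (nesting_sign u C * \<psi> (u, \<tau>(C' := Plus, C := Minus)))) = (\<Sum>C\<in>P. X C C')"
    proof (rule sum.cong[OF refl])
      fix C assume "C \<in> P"
      then have "\<tau>(C' := Plus, C := Minus) = \<tau>(C := Minus, C' := Plus)"
        using C'P by (intro fun_upd_twist) auto
      then show "nesting_sign u C' * (nesting_sign u C * \<psi> (u, \<tau>(C' := Plus, C := Minus))) = X C C'"
        by (simp add: X_def)
    qed
    ultimately show "nesting_sign u C' * (\<Sum>C | C \<in> essential u \<and> (\<tau>(C' := other Minus)) C = Plus.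
        nesting_sign u C * \<psi> (u, \<tau>(C' := other Minus, C := other Plus))) = \<psi> (u, \<tau>) + (\<Sum>C\<in>P. X C C')"
      using fin by (simp add: distrib_left sum_distrib_left sq)
  qed
  have k: "k_grading D S = int (card P) - int (card M)"
  proof -
    have "\<tau> C = Plus \<or> \<tau> C = Minus" for C by (cases "\<tau> C") auto
    then have "essential u = P \<union> M" "P \<inter> M = {}" by (auto simp: P_def M_def)
    then have "k_grading D S = (\<Sum>C\<in>P. label_weight (\<tau> C)) + (\<Sum>C\<in>M. label_weight (\<tau> C))"
      using fin by (simp add: S k_grading_essential sum.union_disjoint)
    also have "(\<Sum>C\<in>P. label_weight (\<tau> C)) = (\<Sum>C\<in>P. 1)"
      by (rule sum.cong) (simp_all add: P_def label_weight_def)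
    also have "(\<Sum>C\<in>M. label_weight (\<tau> C)) = (\<Sum>C\<in>M. - 1)"
      by (rule sum.cong) (simp_all add: M_def label_weight_def)
    finally show ?thesis by simp
  qed
  have sw: "(\<Sum>C\<in>P. \<Sum>C'\<in>M. X C C') = (\<Sum>C'\<in>M. \<Sum>C\<in>P. X C C')" by (rule sum.swap)
  have kc: "of_int (k_grading D S) = (of_nat (card P) - of_nat (card M) :: complex)"
    unfolding k by simp
  show ?thesis unfolding pm mp kc sum.distrib sw by (simp add: algebra_simps)
qed

section \<open>Matrix entries of the differential of k-degree 0\<close>

definition cube_sign :: "bool list \<Rightarrow> bool list \<Rightarrow> complex" where
  "cube_sign u v = (\<Sum>i | i < n \<and> \<not> u ! i \<and> v = u[i := True]. (- 1) ^ card {j. j < i \<and> u ! j})"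

definition edge_entry :: "state \<Rightarrow> state \<Rightarrow> complex" where
  "edge_entry S T = (if k_grading D T = k_grading D S \<and> occurs_in_edge_map D S T then 1 else 0)"

lemma boundary0_entry_eq: "boundary0_entry D S T = cube_sign (fst S) (fst T) * edge_entry S T"
  by (simp add: boundary0_entry_def boundary_entry_def cube_sign_def edge_entry_def)

text \<open>Isolates the condition on the changed circles. Preservation of the k-grading reduces to
  them because the weights of the persisting circles cancel.\<close>

definition local_entry :: "bool list \<Rightarrow> bool list \<Rightarrow> (complex set \<Rightarrow> label) \<Rightarrow> (complex set \<Rightarrow> label) \<Rightarrow> bool" where
  "local_entry u v \<sigma> \<tau> \<longleftrightarrow>
    (\<Sum>C\<in>circles D u - circles D v. circle_weight C (\<sigma> C)) = (\<Sum>C\<in>circles D v - circles D u. circle_weight C (\<tau> C)) \<and>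
    ((\<exists>C1 C2 C. C1 \<noteq> C2 \<and>
         circles D u - circles D v = {C1, C2} \<and> circles D v - circles D u = {C} \<and>
         \<tau> C \<in> merge (\<sigma> C1) (\<sigma> C2)) \<or>
      (\<exists>C C1 C2. C1 \<noteq> C2 \<and>
         circles D u - circles D v = {C} \<and> circles D v - circles D u = {C1, C2} \<and>
         (\<tau> C1, \<tau> C2) \<in> split (\<sigma> C)))"

lemma edge_entry_eq:
  "edge_entry (u, \<sigma>) (v, \<tau>) =
     (if (\<forall>C\<in>circles D u \<inter> circles D v. \<tau> C = \<sigma> C) \<and> local_entry u v \<sigma> \<tau> then 1 else 0)"
proof -
  have split: "(\<Sum>C\<in>X. f C) = (\<Sum>C\<in>X \<inter> Y. f C) + (\<Sum>C\<in>X - Y. f C)" if "finite X"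
    for f :: "complex set \<Rightarrow> int" and X Y
    using sum.Int_Diff[OF that] .
  have kg: "k_grading D (v, \<tau>) = k_grading D (u, \<sigma>) \<longleftrightarrow>
      (\<Sum>C\<in>circles D u - circles D v. circle_weight C (\<sigma> C)) = (\<Sum>C\<in>circles D v - circles D u. circle_weight C (\<tau> C))"
    if "\<forall>C\<in>circles D u \<inter> circles D v. \<tau> C = \<sigma> C"
  proof -
    have "(\<Sum>C\<in>circles D v \<inter> circles D u. circle_weight C (\<tau> C)) =
        (\<Sum>C\<in>circles D u \<inter> circles D v. circle_weight C (\<sigma> C))"
      by (rule sum.cong) (use that in auto)
    then show ?thesis
      unfolding k_grading_eq split[OF circles_jordan(1), of _ u "circles D v"]
        split[OF circles_jordan(1), of _ v "circles D u"] by auto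
  qed
  \<comment> \<open>The weights of the persisting circles cancel only if the labels agree there, so
    the two gradings may be compared under that conjunct alone.\<close>
  have gen: "(if X \<and> A \<and> Z then 1 else 0) = (if A \<and> Y \<and> Z then 1 else (0 :: complex))"
    if "A \<Longrightarrow> X = Y" for A X Y Z using that by auto
  show ?thesis
    unfolding edge_entry_def occurs_in_edge_map_def local_entry_def prod.case
    by (rule gen) (rule kg)
qed

lemma merge_commute: "merge a b = merge b a"
  by (cases a; cases b) auto

lemma split_commute: "(a, b) \<in> split c \<longleftrightarrow> (b, a) \<in> split c"
  by (cases c) auto

text \<open>The definition leaves the order of \<open>C1\<close> and \<open>C2\<close> open;
  commutativity of the product absorbs the choice, as cocommutativity does for a split.\<close>

lemma local_entry_merge:
  assumes "circles D u - circles D v = {C1, C2}" "C1 \<noteq> C2" "circles D v - circles D u = {C}"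
  shows "local_entry u v \<sigma> \<tau> \<longleftrightarrow> \<tau> C \<in> merge (\<sigma> C1) (\<sigma> C2) \<and>
    circle_weight C1 (\<sigma> C1) + circle_weight C2 (\<sigma> C2) = circle_weight C (\<tau> C)"
  using assms(2) merge_commute[of "\<sigma> C1" "\<sigma> C2"]
  unfolding local_entry_def assms(1,3) by (auto simp: doubleton_eq_iff)

lemma local_entry_split:
  assumes "circles D v - circles D u = {C1, C2}" "C1 \<noteq> C2" "circles D u - circles D v = {C}"
  shows "local_entry u v \<sigma> \<tau> \<longleftrightarrow> (\<tau> C1, \<tau> C2) \<in> split (\<sigma> C) \<and>
    circle_weight C1 (\<tau> C1) + circle_weight C2 (\<tau> C2) = circle_weight C (\<sigma> C)"
  using assms(2) split_commute[of "\<tau> C1" "\<tau> C2" "\<sigma> C"]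
  unfolding local_entry_def assms(1,3) by (auto simp: doubleton_eq_iff)

text \<open>Any entry exhibits a merge or a split; edges without entries form a case of their own,
  in which every claim about entries is vacuous.\<close>

lemma local_entry_cases:
  obtains (none) "\<And>\<sigma> \<tau>. \<not> local_entry u v \<sigma> \<tau>"
  | (merge) C1 C2 C where "circles D u - circles D v = {C1, C2}" "C1 \<noteq> C2" "circles D v - circles D u = {C}"
  | (split) C1 C2 C where "circles D v - circles D u = {C1, C2}" "C1 \<noteq> C2" "circles D u - circles D v = {C}"
proof (cases "\<exists>\<sigma> \<tau>. local_entry u v \<sigma> \<tau>")
  case True
  then obtain \<sigma> \<tau> where "local_entry u v \<sigma> \<tau>" by blast
  then show ?thesis unfolding local_entry_def using merge split by (elim conjE disjE exE)
next
  case False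
  then show ?thesis using none by blast
qed

lemma essential_Diff: "essential u - essential v = {C \<in> circles D u - circles D v. \<not> trivial_circle C}"
  by (auto simp: essential_def)

text \<open>
  In the remaining cases of trivial and nontrivial circles, no matrix entry is of \<open>k\<close>-degree
  0, so no topology is needed to exclude them.
\<close>

lemma weights_possible:
  "circle_weight C1 a + circle_weight C2 b = circle_weight C c \<Longrightarrow>
   (trivial_circle C1 \<and> trivial_circle C2 \<and> trivial_circle C) \<or>
   (trivial_circle C1 \<and> \<not> trivial_circle C2 \<and> \<not> trivial_circle C) \<or>
   (\<not> trivial_circle C1 \<and> trivial_circle C2 \<and> \<not> trivial_circle C) \<or>
   (\<not> trivial_circle C1 \<and> \<not> trivial_circle C2 \<and> trivial_circle C)"
  by (cases a; cases b; cases c) (auto simp: circle_weight_def label_weight_def split: if_splits)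

section \<open>The operators on one edge of the cube\<close>

context
  fixes i :: nat and u v :: "bool list"
  assumes i: "i < n" and uv: "\<And>j. j < n \<Longrightarrow> j \<noteq> i \<Longrightarrow> u ! j = v ! j" "u ! i \<noteq> v ! i"
begin

text \<open>Symmetry of the assumptions allows the sign comparisons for merges to be applied to
  splits read backwards.\<close>

lemma vu: "\<And>j. j < n \<Longrightarrow> j \<noteq> i \<Longrightarrow> v ! j = u ! j" "v ! i \<noteq> u ! i"
  using uv by auto

text \<open>By its balance of weights, an entry leaves three possibilities: the nontrivial circles
  are unchanged, one replaces another, or a pair disappears or appears. The parity of the depth of a
  persisting circle is the same in all of them.\<close>

lemma nesting_sign_common:
  assumes L: "local_entry u v \<sigma> \<tau>" and C: "C \<in> essential u \<inter> essential v"
  shows "nesting_sign u C = nesting_sign v C"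
proof (cases rule: local_entry_cases[of u v])
  case none
  then show ?thesis using L by blast
next
  case (merge C1 C2 C0)
  have "circle_weight C1 (\<sigma> C1) + circle_weight C2 (\<sigma> C2) = circle_weight C0 (\<tau> C0)"
    using L unfolding local_entry_merge[OF merge] by blast
  note w = weights_possible[OF this]
  have d: "essential u - essential v = {C \<in> {C1, C2}. \<not> trivial_circle C}"
    "essential v - essential u = {C \<in> {C0}. \<not> trivial_circle C}"
    unfolding essential_Diff merge by auto
  from w show ?thesis
  proof (elim disjE conjE)
    assume "trivial_circle C1" "trivial_circle C2" "trivial_circle C0"
    then have "essential u = essential v" using d by auto
    then show ?thesis by (simp add: nesting_sign_def)
  next
    assume "trivial_circle C1" "\<not> trivial_circle C2" "\<not> trivial_circle C0"
    then have "essential u - essential v = {C2}" "essential v - essential u = {C0}" using d by auto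
    from nesting_sign_one(2)[OF i uv this C] show ?thesis by simp
  next
    assume "\<not> trivial_circle C1" "trivial_circle C2" "\<not> trivial_circle C0"
    then have "essential u - essential v = {C1}" "essential v - essential u = {C0}" using d by auto
    from nesting_sign_one(2)[OF i uv this C] show ?thesis by simp
  next
    assume "\<not> trivial_circle C1" "\<not> trivial_circle C2" "trivial_circle C0"
    then have "essential u - essential v = {C1, C2}" "essential v - essential u = {}" using d by auto
    from nesting_sign_two(2)[OF i uv this(1) merge(2) this(2) C] show ?thesis by simp
  qed
next
  case (split C1 C2 C0)
  have "circle_weight C1 (\<tau> C1) + circle_weight C2 (\<tau> C2) = circle_weight C0 (\<sigma> C0)"
    using L unfolding local_entry_split[OF split] by blast
  note w = weights_possible[OF this]
  have d: "essential v - essential u = {C \<in> {C1, C2}. \<not> trivial_circle C}"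
    "essential u - essential v = {C \<in> {C0}. \<not> trivial_circle C}"
    unfolding essential_Diff split by auto
  have C': "C \<in> essential v \<inter> essential u" using C by blast
  from w show ?thesis
  proof (elim disjE conjE)
    assume "trivial_circle C1" "trivial_circle C2" "trivial_circle C0"
    then have "essential u = essential v" using d by auto
    then show ?thesis by (simp add: nesting_sign_def)
  next
    assume "trivial_circle C1" "\<not> trivial_circle C2" "\<not> trivial_circle C0"
    then have "essential v - essential u = {C2}" "essential u - essential v = {C0}" using d by auto
    from nesting_sign_one(2)[OF i vu this C'] show ?thesis by simp
  next
    assume "\<not> trivial_circle C1" "trivial_circle C2" "\<not> trivial_circle C0"
    then have "essential v - essential u = {C1}" "essential u - essential v = {C0}" using d by auto
    from nesting_sign_one(2)[OF i vu this C'] show ?thesis by simp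
  next
    assume "\<not> trivial_circle C1" "\<not> trivial_circle C2" "trivial_circle C0"
    then have "essential v - essential u = {C1, C2}" "essential u - essential v = {}" using d by auto
    from nesting_sign_two(2)[OF i vu this(1) split(2) this(2) C'] show ?thesis by simp
  qed
qed

text \<open>The commutation on the changed circles, where the signs do their work. Each choice of
  trivial and nontrivial circles and of labels leaves an identity between at most three signed
  terms.\<close>

lemma local_shift:
  "(\<Sum>C | C \<in> essential u - essential v \<and> \<sigma> C = other l.
      nesting_sign u C * of_bool (local_entry u v (\<sigma>(C := l)) \<tau>)) =
   (\<Sum>C | C \<in> essential v - essential u \<and> \<tau> C = l.
      nesting_sign v C * of_bool (local_entry u v \<sigma> (\<tau>(C := other l))))"
proof -
  \<comment> \<open>Expands the sums into single terms, which the case distinctions can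
    evaluate.\<close>
  have filter2: "(\<Sum>C | C \<in> {C \<in> {a, b}. \<not> trivial_circle C} \<and> P C. f C) =
      (if \<not> trivial_circle a \<and> P a then f a else 0) + (if \<not> trivial_circle b \<and> P b then f b else 0)"
    if "a \<noteq> b" for a b P and f :: "complex set \<Rightarrow> complex"
    using sum.inter_filter[of "{a, b}" f "\<lambda>C. \<not> trivial_circle C \<and> P C"] that by (simp add: conj_assoc)
  have filter1: "(\<Sum>C | C \<in> {C \<in> {a}. \<not> trivial_circle C} \<and> P C. f C) =
      (if \<not> trivial_circle a \<and> P a then f a else 0)" for a P and f :: "complex set \<Rightarrow> complex"
    using sum.inter_filter[of "{a}" f "\<lambda>C. \<not> trivial_circle C \<and> P C"] by (simp add: conj_assoc)
  show ?thesis
  proof (cases rule: local_entry_cases[of u v])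
    case none
    then show ?thesis by simp
  next
    case (merge C1 C2 C0)
    have ne: "C0 \<noteq> C1" "C0 \<noteq> C2" "C1 \<noteq> C0" "C2 \<noteq> C0" "C1 \<noteq> C2" "C2 \<noteq> C1" using merge by auto
    have d: "essential u - essential v = {C \<in> {C1, C2}. \<not> trivial_circle C}"
      "essential v - essential u = {C \<in> {C0}. \<not> trivial_circle C}"
      unfolding essential_Diff merge by auto
    have s1: "nesting_sign u C2 = nesting_sign v C0"
      if "trivial_circle C1" "\<not> trivial_circle C2" "\<not> trivial_circle C0"
      by (rule nesting_sign_one(1)[OF i uv]) (use that d in auto)
    have s2: "nesting_sign u C1 = nesting_sign v C0"
      if "\<not> trivial_circle C1" "trivial_circle C2" "\<not> trivial_circle C0"
      by (rule nesting_sign_one(1)[OF i uv]) (use that d in auto)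
    \<comment> \<open>If two nontrivial circles with equal labels merge into a trivial one,
      relabelling either of them yields a pair that is sent to \<open>x\<close>; the opposite signs
      cancel these two terms.\<close>
    have s3: "nesting_sign u C1 = - nesting_sign u C2"
      if "\<not> trivial_circle C1" "\<not> trivial_circle C2" "trivial_circle C0"
      by (rule nesting_sign_two(1)[OF i uv]) (use that d merge(2) in auto)
    show ?thesis
      unfolding d local_entry_merge[OF merge] filter1 filter2[OF merge(2)]
      by (cases "trivial_circle C1"; cases "trivial_circle C2"; cases "trivial_circle C0";
          cases "\<sigma> C1"; cases "\<sigma> C2"; cases "\<tau> C0"; cases l)
        (simp_all add: ne circle_weight_def label_weight_def s1 s2 s3)
  next
    case (split C1 C2 C0)
    have ne: "C0 \<noteq> C1" "C0 \<noteq> C2" "C1 \<noteq> C0" "C2 \<noteq> C0" "C1 \<noteq> C2" "C2 \<noteq> C1" using split by auto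
    have d: "essential v - essential u = {C \<in> {C1, C2}. \<not> trivial_circle C}"
      "essential u - essential v = {C \<in> {C0}. \<not> trivial_circle C}"
      unfolding essential_Diff split by auto
    have s1: "nesting_sign v C2 = nesting_sign u C0"
      if "trivial_circle C1" "\<not> trivial_circle C2" "\<not> trivial_circle C0"
      by (rule nesting_sign_one(1)[OF i vu]) (use that d in auto)
    have s2: "nesting_sign v C1 = nesting_sign u C0"
      if "\<not> trivial_circle C1" "trivial_circle C2" "\<not> trivial_circle C0"
      by (rule nesting_sign_one(1)[OF i vu]) (use that d in auto)
    have s3: "nesting_sign v C1 = - nesting_sign v C2"
      if "\<not> trivial_circle C1" "\<not> trivial_circle C2" "trivial_circle C0"
      by (rule nesting_sign_two(1)[OF i vu]) (use that d split(2) in auto)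
    show ?thesis
      unfolding d local_entry_split[OF split] filter1 filter2[OF split(2)]
      by (cases "trivial_circle C1"; cases "trivial_circle C2"; cases "trivial_circle C0";
          cases "\<tau> C1"; cases "\<tau> C2"; cases "\<sigma> C0"; cases l)
        (simp_all add: ne circle_weight_def label_weight_def s1 s2 s3)
  qed
qed

end

lemma local_entry_cong:
  assumes "\<And>C. C \<in> circles D u - circles D v \<Longrightarrow> \<sigma> C = \<sigma>' C"
    "\<And>C. C \<in> circles D v - circles D u \<Longrightarrow> \<tau> C = \<tau>' C"
  shows "local_entry u v \<sigma> \<tau> \<longleftrightarrow> local_entry u v \<sigma>' \<tau>'"
proof (cases rule: local_entry_cases[of u v])
  case none
  then show ?thesis by simp
next
  case (merge C1 C2 C0)
  have "\<sigma> C1 = \<sigma>' C1" "\<sigma> C2 = \<sigma>' C2" "\<tau> C0 = \<tau>' C0"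
    using assms unfolding merge by simp_all
  then show ?thesis unfolding local_entry_merge[OF merge] by simp
next
  case (split C1 C2 C0)
  have "\<tau> C1 = \<tau>' C1" "\<tau> C2 = \<tau>' C2" "\<sigma> C0 = \<sigma>' C0"
    using assms unfolding split by simp_all
  then show ?thesis unfolding local_entry_split[OF split] by simp
qed

text \<open>The left side is the matrix entry of the operator followed by the edge map, the right
  side that of the edge map followed by the operator. Persisting circles are compared term by term,
  changed ones through \<open>local_shift\<close>.\<close>

lemma edge_entry_shift:
  assumes i: "i < n" and uv: "\<And>j. j < n \<Longrightarrow> j \<noteq> i \<Longrightarrow> u ! j = v ! j" "u ! i \<noteq> v ! i"
  shows "(\<Sum>C | C \<in> essential u \<and> \<sigma> C = other l. nesting_sign u C * edge_entry (u, \<sigma>(C := l)) (v, \<tau>)) =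
    (\<Sum>C | C \<in> essential v \<and> \<tau> C = l. nesting_sign v C * edge_entry (u, \<sigma>) (v, \<tau>(C := other l)))"
proof -
  let ?agree = "\<lambda>\<sigma> \<tau>. \<forall>C\<in>circles D u \<inter> circles D v. \<tau> C = \<sigma> C"
  have part: "(\<Sum>C | C \<in> A \<and> P C. f C) = (\<Sum>C\<in>A \<inter> B. if P C then f C else 0) + (\<Sum>C | C \<in> A - B \<and> P C. f C)"
    if "finite A" for A B P and f :: "complex set \<Rightarrow> complex"
  proof -
    have "(\<Sum>C\<in>A \<inter> B. if P C then f C else 0) = (\<Sum>C | C \<in> A \<inter> B \<and> P C. f C)"
      using sum.inter_filter[of "A \<inter> B" f P] that by simp
    moreover have "{C. C \<in> A \<and> P C} = {C. C \<in> A \<inter> B \<and> P C} \<union> {C. C \<in> A - B \<and> P C}" by auto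
    moreover have "sum f ({C. C \<in> A \<inter> B \<and> P C} \<union> {C. C \<in> A - B \<and> P C}) =
        sum f {C. C \<in> A \<inter> B \<and> P C} + sum f {C. C \<in> A - B \<and> P C}"
      by (rule sum.union_disjoint) (use that in auto)
    ultimately show ?thesis by simp
  qed
  have common: "(if \<sigma> C = other l then nesting_sign u C * edge_entry (u, \<sigma>(C := l)) (v, \<tau>) else 0) =
      (if \<tau> C = l then nesting_sign v C * edge_entry (u, \<sigma>) (v, \<tau>(C := other l)) else 0)"
    if C: "C \<in> essential u \<inter> essential v" for C
  proof -
    have CC: "C \<in> circles D u \<inter> circles D v" using C by (auto simp: essential_def)
    have L: "local_entry u v (\<sigma>(C := l)) \<tau> \<longleftrightarrow> local_entry u v \<sigma> \<tau>"
      "local_entry u v \<sigma> (\<tau>(C := other l)) \<longleftrightarrow> local_entry u v \<sigma> \<tau>"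
      by (rule local_entry_cong; use CC in auto)+
    \<comment> \<open>Together with the side conditions of the two sums, both orders require
      \<open>\<sigma> C = other l\<close>, \<open>\<tau> C = l\<close> and agreement on the
      remaining persisting circles.\<close>
    have "?agree (\<sigma>(C := l)) \<tau> \<longleftrightarrow> \<tau> C = l \<and> (\<forall>C'\<in>circles D u \<inter> circles D v - {C}. \<tau> C' = \<sigma> C')"
      using CC by auto
    moreover have "?agree \<sigma> (\<tau>(C := other l)) \<longleftrightarrow>
        \<sigma> C = other l \<and> (\<forall>C'\<in>circles D u \<inter> circles D v - {C}. \<tau> C' = \<sigma> C')"
      using CC by auto
    ultimately show ?thesis
      using nesting_sign_common[OF i uv _ C, of \<sigma> \<tau>] unfolding edge_entry_eq L by auto
  qed
  have localu: "edge_entry (u, \<sigma>(C := l)) (v, \<tau>) =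
      of_bool (?agree \<sigma> \<tau>) * of_bool (local_entry u v (\<sigma>(C := l)) \<tau>)"
    if "C \<in> essential u - essential v" for C
  proof -
    have "C \<notin> circles D u \<inter> circles D v" using that by (auto simp: essential_def)
    then have "?agree (\<sigma>(C := l)) \<tau> \<longleftrightarrow> ?agree \<sigma> \<tau>" by auto
    then show ?thesis unfolding edge_entry_eq by simp
  qed
  have localv: "edge_entry (u, \<sigma>) (v, \<tau>(C := other l)) =
      of_bool (?agree \<sigma> \<tau>) * of_bool (local_entry u v \<sigma> (\<tau>(C := other l)))"
    if "C \<in> essential v - essential u" for C
  proof -
    have "C \<notin> circles D u \<inter> circles D v" using that by (auto simp: essential_def)
    then have "?agree \<sigma> (\<tau>(C := other l)) \<longleftrightarrow> ?agree \<sigma> \<tau>" by auto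
    then show ?thesis unfolding edge_entry_eq by simp
  qed
  have "(\<Sum>C | C \<in> essential u - essential v \<and> \<sigma> C = other l.
        nesting_sign u C * edge_entry (u, \<sigma>(C := l)) (v, \<tau>)) =
      of_bool (?agree \<sigma> \<tau>) * (\<Sum>C | C \<in> essential u - essential v \<and> \<sigma> C = other l.
        nesting_sign u C * of_bool (local_entry u v (\<sigma>(C := l)) \<tau>))"
    unfolding sum_distrib_left by (rule sum.cong) (simp_all add: localu)
  also have "\<dots> = of_bool (?agree \<sigma> \<tau>) * (\<Sum>C | C \<in> essential v - essential u \<and> \<tau> C = l.
        nesting_sign v C * of_bool (local_entry u v \<sigma> (\<tau>(C := other l))))"
    using local_shift[OF i uv] by simp
  also have "\<dots> = (\<Sum>C | C \<in> essential v - essential u \<and> \<tau> C = l.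
        nesting_sign v C * edge_entry (u, \<sigma>) (v, \<tau>(C := other l)))"
    unfolding sum_distrib_left by (rule sum.cong) (simp_all add: localv)
  finally have rest: "(\<Sum>C | C \<in> essential u - essential v \<and> \<sigma> C = other l.
        nesting_sign u C * edge_entry (u, \<sigma>(C := l)) (v, \<tau>)) = \<dots>" .
  have "(\<Sum>C\<in>essential u \<inter> essential v.
        if \<sigma> C = other l then nesting_sign u C * edge_entry (u, \<sigma>(C := l)) (v, \<tau>) else 0) =
      (\<Sum>C\<in>essential v \<inter> essential u.
        if \<tau> C = l then nesting_sign v C * edge_entry (u, \<sigma>) (v, \<tau>(C := other l)) else 0)"
    by (rule sum.cong) (use common in auto)
  then show ?thesis
    unfolding part[of "essential u" _ _ "essential v", OF finite_essential]
      part[of "essential v" _ _ "essential u", OF finite_essential] rest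
    by simp
qed

section \<open>Commutation with the differential\<close>

definition labellings :: "bool list \<Rightarrow> (complex set \<Rightarrow> label) set" where
  "labellings u = (circles D u \<rightarrow>\<^sub>E UNIV)"

lemma states_Sigma: "states D = Sigma {u. length u = n} labellings"
  by (auto simp: states_def labellings_def)

lemma labellings_upd: "C \<in> circles D u \<Longrightarrow> \<tau>(C := l) \<in> labellings u \<longleftrightarrow> \<tau> \<in> labellings u"
  by (auto simp: labellings_def PiE_iff extensional_def)

lemma finite_labellings: "length u = n \<Longrightarrow> finite (labellings u)"
  using finite_subset[of "Pair u ` labellings u" "states D"] finite_states
  by (auto simp: states_Sigma finite_image_iff inj_on_def)

lemma sum_states:
  "(\<Sum>S\<in>states D. f S) = (\<Sum>u | length u = n. \<Sum>\<sigma>\<in>labellings u. f (u, \<sigma>))"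
proof -
  have "finite {u :: bool list. length u = n}"
    using finite_lists_length_eq[of "UNIV :: bool set" n] by simp
  then show ?thesis unfolding states_Sigma using finite_labellings by (subst sum.Sigma) auto
qed

lemma boundary0_sum:
  assumes "(v, \<tau>) \<in> states D"
  shows "boundary0 D \<psi> (v, \<tau>) = (\<Sum>u | length u = n. cube_sign u v *
    (\<Sum>\<sigma>\<in>labellings u. edge_entry (u, \<sigma>) (v, \<tau>) * \<psi> (u, \<sigma>)))"
  using assms unfolding boundary0_def boundary0_entry_eq
  by (simp add: sum_states sum_distrib_left mult.assoc)

text \<open>Relabelling \<open>C\<close> is a bijection between the labellings with the two values
  at \<open>C\<close>. This moves the operator from the chain to the matrix entry.\<close>

lemma sum_labellings_shift:
  fixes g :: "complex set \<Rightarrow> (complex set \<Rightarrow> label) \<Rightarrow> (complex set \<Rightarrow> label) \<Rightarrow> complex"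
  assumes "length u = n"
  shows "(\<Sum>\<sigma>\<in>labellings u. \<Sum>C | C \<in> essential u \<and> \<sigma> C = l. g C \<sigma> (\<sigma>(C := other l))) =
    (\<Sum>\<sigma>\<in>labellings u. \<Sum>C | C \<in> essential u \<and> \<sigma> C = other l. g C (\<sigma>(C := l)) \<sigma>)"
proof -
  have flt: "(\<Sum>C | C \<in> essential u \<and> P C. f C) = (\<Sum>C\<in>essential u. if P C then f C else 0)"
    for P and f :: "complex set \<Rightarrow> complex"
    using sum.inter_filter[OF finite_essential[of u], of f P] by simp
  have "(\<Sum>\<sigma>\<in>labellings u. if \<sigma> C = l then g C \<sigma> (\<sigma>(C := other l)) else 0) =
      (\<Sum>\<sigma>\<in>labellings u. if \<sigma> C = other l then g C (\<sigma>(C := l)) \<sigma> else 0)"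
    if "C \<in> essential u" for C
  proof -
    have C: "C \<in> circles D u" using that by (simp add: essential_def)
    have "(\<Sum>\<sigma> | \<sigma> \<in> labellings u \<and> \<sigma> C = l. g C \<sigma> (\<sigma>(C := other l))) =
      (\<Sum>\<sigma> | \<sigma> \<in> labellings u \<and> \<sigma> C = other l. g C (\<sigma>(C := l)) \<sigma>)"
      by (rule sum.reindex_bij_witness[of _ "\<lambda>\<sigma>. \<sigma>(C := l)" "\<lambda>\<sigma>. \<sigma>(C := other l)"])
        (auto simp: labellings_upd[OF C])
    then show ?thesis using finite_labellings[OF assms] by (simp add: sum.inter_filter)
  qed
  then show ?thesis unfolding flt
    by (subst (1 2) sum.swap) (rule sum.cong, simp_all)
qed

lemma cube_sign_edge:
  assumes "length u = n" "cube_sign u v \<noteq> 0"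
  obtains i where "i < n" "\<And>j. j < n \<Longrightarrow> j \<noteq> i \<Longrightarrow> u ! j = v ! j" "u ! i \<noteq> v ! i"
proof -
  obtain i where i: "i < n" "\<not> u ! i" "v = u[i := True]"
    using assms(2) unfolding cube_sign_def by (rule sum.not_neutral_contains_not_neutral) auto
  then show ?thesis using that[of i] assms(1) by simp
qed

text \<open>The operator keeps the vertex of the cube, so the cube signs factor out and the claim
  reduces to \<open>edge_entry_shift\<close> on single edges.\<close>

lemma boundary0_shift: "boundary0 D (shift l \<psi>) = shift l (boundary0 D \<psi>)"
proof (rule ext)
  fix T :: state obtain v \<tau> where T: "T = (v, \<tau>)" by force
  have ess: "(v, \<tau>(C := l')) \<in> states D \<longleftrightarrow> (v, \<tau>) \<in> states D" if "C \<in> essential v" for C l'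
    using that by (intro states_upd) (simp add: essential_def)
  show "boundary0 D (shift l \<psi>) T = shift l (boundary0 D \<psi>) T"
  proof (cases "T \<in> states D")
    case False
    then have "boundary0 D \<psi> (v, \<tau>(C := other l)) = 0" if "C \<in> essential v" for C
      using ess[OF that] T by (simp add: boundary0_def)
    then show ?thesis using False by (simp add: T shift_def boundary0_def)
  next
    case True
    let ?Eu = "\<lambda>u \<sigma>. \<Sum>C | C \<in> essential u \<and> \<sigma> C = other l. nesting_sign u C * edge_entry (u, \<sigma>(C := l)) (v, \<tau>)"
    let ?Ev = "\<lambda>u \<sigma>. \<Sum>C | C \<in> essential v \<and> \<tau> C = l. nesting_sign v C * edge_entry (u, \<sigma>) (v, \<tau>(C := other l))"
    have "(\<Sum>\<sigma>\<in>labellings u. edge_entry (u, \<sigma>) (v, \<tau>) * shift l \<psi> (u, \<sigma>)) =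
        (\<Sum>\<sigma>\<in>labellings u. ?Eu u \<sigma> * \<psi> (u, \<sigma>))" if u: "length u = n" for u
    proof -
      have "(\<Sum>\<sigma>\<in>labellings u. edge_entry (u, \<sigma>) (v, \<tau>) * shift l \<psi> (u, \<sigma>)) =
        (\<Sum>\<sigma>\<in>labellings u. \<Sum>C | C \<in> essential u \<and> \<sigma> C = l.
          nesting_sign u C * edge_entry (u, \<sigma>) (v, \<tau>) * \<psi> (u, \<sigma>(C := other l)))"
        by (simp add: shift_def sum_distrib_left algebra_simps)
      also have "\<dots> = (\<Sum>\<sigma>\<in>labellings u. ?Eu u \<sigma> * \<psi> (u, \<sigma>))"
        unfolding sum_labellings_shift[OF u, of "\<lambda>C \<sigma> \<sigma>'. nesting_sign u C * edge_entry (u, \<sigma>) (v, \<tau>) * \<psi> (u, \<sigma>')" l]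
        by (simp add: sum_distrib_right)
      finally show ?thesis .
    qed
    then have "boundary0 D (shift l \<psi>) T =
        (\<Sum>u | length u = n. cube_sign u v * (\<Sum>\<sigma>\<in>labellings u. ?Eu u \<sigma> * \<psi> (u, \<sigma>)))"
      unfolding T boundary0_sum[OF True[unfolded T]] by (intro sum.cong) simp_all
    also have "\<dots> = (\<Sum>u | length u = n. cube_sign u v * (\<Sum>\<sigma>\<in>labellings u. ?Ev u \<sigma> * \<psi> (u, \<sigma>)))"
    proof (rule sum.cong[OF refl])
      fix u assume "u \<in> {u :: bool list. length u = n}"
      then have u: "length u = n" by simp
      show "cube_sign u v * (\<Sum>\<sigma>\<in>labellings u. ?Eu u \<sigma> * \<psi> (u, \<sigma>)) =
        cube_sign u v * (\<Sum>\<sigma>\<in>labellings u. ?Ev u \<sigma> * \<psi> (u, \<sigma>))"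
      \<comment> \<open>A nonzero cube sign supplies the edge on which the entries are compared;
        otherwise both sides vanish.\<close>
      proof (cases "cube_sign u v = 0")
        case False
        obtain i where i: "i < n" "\<And>j. j < n \<Longrightarrow> j \<noteq> i \<Longrightarrow> u ! j = v ! j" "u ! i \<noteq> v ! i"
          using cube_sign_edge[OF u False] by blast
        have "?Eu u \<sigma> = ?Ev u \<sigma>" for \<sigma> by (rule edge_entry_shift[OF i])
        then show ?thesis by (simp only:)
      qed simp
    qed
    also have "\<dots> = (\<Sum>u | length u = n. \<Sum>\<sigma>\<in>labellings u. \<Sum>C | C \<in> essential v \<and> \<tau> C = l.
        nesting_sign v C * (cube_sign u v * (edge_entry (u, \<sigma>) (v, \<tau>(C := other l)) * \<psi> (u, \<sigma>))))"
      by (simp add: sum_distrib_left sum_distrib_right algebra_simps)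
    also have "\<dots> = (\<Sum>C | C \<in> essential v \<and> \<tau> C = l. \<Sum>u | length u = n. \<Sum>\<sigma>\<in>labellings u.
        nesting_sign v C * (cube_sign u v * (edge_entry (u, \<sigma>) (v, \<tau>(C := other l)) * \<psi> (u, \<sigma>))))"
      by (subst sum.swap, rule sum.cong[OF refl], rule sum.swap)
    also have "\<dots> = (\<Sum>C | C \<in> essential v \<and> \<tau> C = l. nesting_sign v C * boundary0 D \<psi> (v, \<tau>(C := other l)))"
    proof (rule sum.cong[OF refl])
      fix C assume "C \<in> {C. C \<in> essential v \<and> \<tau> C = l}"
      then have "(v, \<tau>(C := other l)) \<in> states D" using ess[of C] True T by simp
      from boundary0_sum[OF this]
      show "(\<Sum>u | length u = n. \<Sum>\<sigma>\<in>labellings u.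
          nesting_sign v C * (cube_sign u v * (edge_entry (u, \<sigma>) (v, \<tau>(C := other l)) * \<psi> (u, \<sigma>)))) =
        nesting_sign v C * boundary0 D \<psi> (v, \<tau>(C := other l))"
        by (simp add: sum_distrib_left)
    qed
    finally show ?thesis by (simp add: T shift_def)
  qed
qed

section \<open>Exchanging the labels of nontrivial circles\<close>

definition flip_labels :: "bool list \<Rightarrow> (complex set \<Rightarrow> label) \<Rightarrow> complex set \<Rightarrow> label" where
  "flip_labels u \<tau> = (\<lambda>C. if C \<in> essential u then other (\<tau> C) else \<tau> C)"

lemma flip_eq: "flip \<psi> (u, \<tau>) = \<psi> (u, flip_labels u \<tau>)"
  by (simp add: flip_def flip_labels_def)

lemma flip_labels_flip_labels [simp]: "flip_labels u (flip_labels u \<tau>) = \<tau>"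
  by (auto simp: flip_labels_def)

lemma flip_labels_labellings [simp]: "flip_labels u \<tau> \<in> labellings u \<longleftrightarrow> \<tau> \<in> labellings u"
  by (auto simp: flip_labels_def labellings_def PiE_iff extensional_def essential_def)

lemma k_grading_flip: "k_grading D (u, flip_labels u \<tau>) = - k_grading D (u, \<tau>)"
proof -
  have "label_weight (other l) = - label_weight l" for l by (cases l) (simp_all add: label_weight_def)
  then show ?thesis unfolding k_grading_essential by (simp add: flip_labels_def sum_negf)
qed

lemma flip_CKh: "\<psi> \<in> CKh D k \<Longrightarrow> flip \<psi> \<in> CKh D (- k)"
  using k_grading_flip unfolding CKh_def by (force simp: flip_eq states_Sigma)

text \<open>In k-degree 0, merging a trivial circle into a nontrivial one acts on both labels of the
  latter alike, as the identity for \<open>w\<^sub>+\<close> and as zero for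
  \<open>w\<^sub>-\<close>; the pairing of two nontrivial circles is symmetric. Splits are dual. The
  exchange therefore carries no signs, in contrast to \<open>shift\<close>.\<close>

lemma edge_entry_flip: "edge_entry (u, flip_labels u \<sigma>) (v, \<tau>) = edge_entry (u, \<sigma>) (v, flip_labels v \<tau>)"
proof -
  have ag: "\<tau> C = flip_labels u \<sigma> C \<longleftrightarrow> flip_labels v \<tau> C = \<sigma> C" if "C \<in> circles D u \<inter> circles D v" for C
    using that by (cases "\<tau> C"; cases "\<sigma> C") (simp_all add: flip_labels_def essential_def)
  have "local_entry u v (flip_labels u \<sigma>) \<tau> \<longleftrightarrow> local_entry u v \<sigma> (flip_labels v \<tau>)"
  proof (cases rule: local_entry_cases[of u v])
    case none
    then show ?thesis by simp
  next
    case (merge C1 C2 C0)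
    have e: "C1 \<in> essential u \<longleftrightarrow> \<not> trivial_circle C1" "C2 \<in> essential u \<longleftrightarrow> \<not> trivial_circle C2"
      "C0 \<in> essential v \<longleftrightarrow> \<not> trivial_circle C0" using merge by (auto simp: essential_def)
    show ?thesis unfolding local_entry_merge[OF merge] flip_labels_def e
      by (cases "trivial_circle C1"; cases "trivial_circle C2"; cases "trivial_circle C0";
          cases "\<sigma> C1"; cases "\<sigma> C2"; cases "\<tau> C0") (simp_all add: circle_weight_def label_weight_def)
  next
    case (split C1 C2 C0)
    have e: "C1 \<in> essential v \<longleftrightarrow> \<not> trivial_circle C1" "C2 \<in> essential v \<longleftrightarrow> \<not> trivial_circle C2"
      "C0 \<in> essential u \<longleftrightarrow> \<not> trivial_circle C0" using split by (auto simp: essential_def)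
    show ?thesis unfolding local_entry_split[OF split] flip_labels_def e
      by (cases "trivial_circle C1"; cases "trivial_circle C2"; cases "trivial_circle C0";
          cases "\<tau> C1"; cases "\<tau> C2"; cases "\<sigma> C0") (simp_all add: circle_weight_def label_weight_def)
  qed
  then show ?thesis unfolding edge_entry_eq using ag by simp
qed

lemma boundary0_flip: "boundary0 D (flip \<psi>) = flip (boundary0 D \<psi>)"
proof (rule ext)
  fix T :: state obtain v \<tau> where T: "T = (v, \<tau>)" by force
  have st: "(v, flip_labels v \<tau>) \<in> states D \<longleftrightarrow> (v, \<tau>) \<in> states D" by (simp add: states_Sigma)
  show "boundary0 D (flip \<psi>) T = flip (boundary0 D \<psi>) T"
  proof (cases "T \<in> states D")
    case True
    have "(\<Sum>\<sigma>\<in>labellings u. edge_entry (u, \<sigma>) (v, \<tau>) * \<psi> (u, flip_labels u \<sigma>)) =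
      (\<Sum>\<sigma>\<in>labellings u. edge_entry (u, \<sigma>) (v, flip_labels v \<tau>) * \<psi> (u, \<sigma>))" for u
      by (rule sum.reindex_bij_witness[of _ "flip_labels u" "flip_labels u"]) (simp_all flip: edge_entry_flip)
    then show ?thesis using True st unfolding T flip_eq by (simp add: boundary0_sum flip_eq)
  qed (use st in \<open>simp add: T flip_eq boundary0_def\<close>)
qed

end

section \<open>Dimensions of quotients\<close>

definition spans_modulo :: "('s \<Rightarrow> complex) set \<Rightarrow> ('s \<Rightarrow> complex) set \<Rightarrow> ('s \<Rightarrow> complex) set \<Rightarrow> bool" where
  "spans_modulo Z B S \<longleftrightarrow> finite S \<and> S \<subseteq> Z \<and> (\<forall>z\<in>Z. \<exists>s\<in>chain.span S. z - s \<in> B)"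

lemma spans_modulo_quotient:
  assumes Z: "chain.subspace Z" and B: "chain.subspace B"
  shows "finite S \<and> S \<subseteq> \<Union>(quotient_space Z B) \<and> (\<forall>X\<in>quotient_space Z B. X \<inter> chain.span S \<noteq> {}) \<longleftrightarrow>
    spans_modulo Z B S"
proof -
  have U: "\<Union>(quotient_space Z B) = Z"
    using chain.subspace_0[OF B] by (auto simp: quotient_space_def quotient_def; metis diff_self)
  have "(\<forall>X\<in>quotient_space Z B. X \<inter> chain.span S \<noteq> {}) \<longleftrightarrow> (\<forall>z\<in>Z. \<exists>s\<in>chain.span S. z - s \<in> B)"
    if "S \<subseteq> Z"
  proof -
    have "chain.span S \<subseteq> Z" using chain.span_minimal[OF that Z] .
    then show ?thesis by (auto simp: quotient_space_def quotient_def; blast)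
  qed
  then show ?thesis unfolding U spans_modulo_def by blast
qed

lemma quotient_dim_eq:
  assumes "chain.subspace Z" "chain.subspace B"
  shows "quotient_dim (quotient_space Z B) = (LEAST m. \<exists>S. card S = m \<and> spans_modulo Z B S)"
  unfolding quotient_dim_def
  by (rule arg_cong[of _ _ Least], intro ext ex_cong1) (use spans_modulo_quotient[OF assms] in blast)

lemma finite_independent_subset:
  assumes "finite F" "Z \<subseteq> chain.span F" "chain.independent A" "A \<subseteq> Z"
  shows "finite A"
  using chain.independent_span_bound[OF assms(1,3)] assms(2,4) by blast

text \<open>\<open>S\<close> is a basis of \<open>Z \<inter> B\<close>, the subspace actually
  divided out, and \<open>T\<close> completes it to a basis of \<open>Z\<close>; so \<open>T\<close>
  represents a basis of the quotient.\<close>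

lemma adapted_basis:
  assumes Z: "chain.subspace Z" and B: "chain.subspace B" and F: "finite F" "Z \<subseteq> chain.span F"
  obtains S T where "chain.independent (S \<union> T)" "S \<inter> T = {}" "finite S" "spans_modulo Z B T"
    "S \<subseteq> Z \<inter> B" "Z \<inter> B \<subseteq> chain.span S"
proof -
  obtain S where S: "S \<subseteq> Z \<inter> B" "chain.independent S" "Z \<inter> B \<subseteq> chain.span S"
    by (rule chain.maximal_independent_subset)
  obtain A where A: "S \<subseteq> A" "A \<subseteq> Z" "chain.independent A" "Z \<subseteq> chain.span A"
    using chain.maximal_independent_subset_extend[of S Z] S by blast
  have fin: "finite A" by (rule finite_independent_subset[OF F A(3,2)])
  have SA: "S \<union> (A - S) = A" using A(1) by blast
  have sB: "chain.span S \<subseteq> B" using chain.span_minimal[OF _ B] S(1) by blast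
  have "\<exists>s\<in>chain.span (A - S). z - s \<in> B" if "z \<in> Z" for z
  proof -
    have "z \<in> chain.span (S \<union> (A - S))" using A(4) that unfolding SA by blast
    then obtain b t where "b \<in> chain.span S" "t \<in> chain.span (A - S)" "z = b + t"
      unfolding chain.span_Un by blast
    then show ?thesis using sB by (intro bexI[of _ t]) auto
  qed
  then have "spans_modulo Z B (A - S)" using fin A(2) unfolding spans_modulo_def by blast
  then show ?thesis using that[of S "A - S"] S A SA fin finite_subset[of S A] by auto
qed

lemma quotient_dim_mono:
  assumes Z: "chain.subspace Z" and B: "chain.subspace B" and F: "finite F" "Z \<subseteq> chain.span F"
    and Z': "chain.subspace Z'" and B': "chain.subspace B'" and F': "finite F'" "Z' \<subseteq> chain.span F'"
    and lin: "Vector_Spaces.linear cscale cscale \<phi>"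
    and ZZ: "\<And>z. z \<in> Z \<Longrightarrow> \<phi> z \<in> Z'" and inj: "\<And>z. z \<in> Z \<Longrightarrow> \<phi> z \<in> B' \<Longrightarrow> z \<in> B"
  shows "quotient_dim (quotient_space Z B) \<le> quotient_dim (quotient_space Z' B')"
proof -
  interpret \<phi>: Vector_Spaces.linear cscale cscale \<phi> by (rule lin)
  obtain S T where ST: "chain.independent (S \<union> T)" "S \<inter> T = {}" "finite S" "spans_modulo Z B T"
      "S \<subseteq> Z \<inter> B" "Z \<inter> B \<subseteq> chain.span S"
    using adapted_basis[OF Z B F] .
  obtain S' T' where ST': "chain.independent (S' \<union> T')" "S' \<inter> T' = {}" "finite S'" "spans_modulo Z' B' T'"
      "S' \<subseteq> Z' \<inter> B'" "Z' \<inter> B' \<subseteq> chain.span S'"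
    using adapted_basis[OF Z' B' F'] .
  have T: "finite T" "T \<subseteq> Z" using ST(4) by (auto simp: spans_modulo_def)
  obtain R where R: "spans_modulo Z' B' R" "card R = quotient_dim (quotient_space Z' B')"
  proof -
    have "\<exists>m S. card S = m \<and> spans_modulo Z' B' S" using ST'(4) by blast
    then have "\<exists>S. card S = quotient_dim (quotient_space Z' B') \<and> spans_modulo Z' B' S"
      unfolding quotient_dim_eq[OF Z' B'] by (rule LeastI_ex)
    then show ?thesis using that by blast
  qed
  have Rf: "finite R" "R \<subseteq> Z'" using R(1) by (auto simp: spans_modulo_def)
  have "T0 \<subseteq> T \<Longrightarrow> chain.independent (\<phi> ` T0 \<union> S') \<and> card (\<phi> ` T0 \<union> S') = card T0 + card S'"
    if "finite T0" for T0
    using that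
  proof (induction T0 rule: finite_induct)
    case empty
    then show ?case using ST'(1) chain.independent_mono[of "S' \<union> T'" S'] by simp
  next
    case (insert t T0)
    \<comment> \<open>A dependence would put \<open>t - x\<close> into \<open>Z \<inter> B\<close>
      by \<open>inj\<close>, hence into the span of \<open>S\<close>, against independence of
      \<open>S \<union> T\<close>.\<close>
    have new: "\<phi> t \<notin> chain.span (\<phi> ` T0 \<union> S')"
    proof
      assume "\<phi> t \<in> chain.span (\<phi> ` T0 \<union> S')"
      then obtain x b where xb: "x \<in> chain.span T0" "b \<in> chain.span S'" "\<phi> t = \<phi> x + b"
        unfolding chain.span_Un \<phi>.span_image by blast
      have "chain.span S' \<subseteq> B'" using chain.span_minimal[OF _ B'] ST'(5) by blast
      then have "\<phi> (t - x) \<in> B'" using xb by (auto simp: \<phi>.diff)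
      moreover have "chain.span T0 \<subseteq> Z" using chain.span_minimal[OF _ Z] insert.prems T by blast
      then have "t - x \<in> Z" using xb(1) insert.prems T chain.subspace_diff[OF Z] by blast
      ultimately have "t - x \<in> chain.span S" using inj ST(6) by blast
      then have "(t - x) + x \<in> chain.span (S \<union> T0)"
        using xb(1) chain.span_mono[of S "S \<union> T0"] chain.span_mono[of T0 "S \<union> T0"]
        by (intro chain.span_add) auto
      moreover have "S \<union> T0 \<subseteq> S \<union> T - {t}" using insert ST(2) by auto
      ultimately have "t \<in> chain.span (S \<union> T - {t})"
        using chain.span_mono[of "S \<union> T0" "S \<union> T - {t}"] by auto
      then show False using ST(1) insert.prems unfolding chain.dependent_def by blast
    qed
    then have new': "\<phi> t \<notin> \<phi> ` T0 \<union> S'"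
      by (rule contrapos_nn) (rule chain.span_base)
    have IH: "chain.independent (\<phi> ` T0 \<union> S')" "card (\<phi> ` T0 \<union> S') = card T0 + card S'"
      using insert.IH insert.prems by simp_all
    have "chain.independent (insert (\<phi> t) (\<phi> ` T0 \<union> S'))"
      unfolding chain.independent_insert using IH(1) new by simp
    moreover have "card (insert (\<phi> t) (\<phi> ` T0 \<union> S')) = card (insert t T0) + card S'"
      using insert.hyps new' ST'(3) IH(2) by (subst card_insert_disjoint) simp_all
    ultimately show ?case by simp
  qed
  from this[OF T(1)] have ind: "chain.independent (\<phi> ` T \<union> S')" "card (\<phi> ` T \<union> S') = card T + card S'" by auto
  have "\<phi> ` T \<union> S' \<subseteq> chain.span (R \<union> S')"
  proof -
    have "y \<in> chain.span (R \<union> S')" if "y \<in> Z'" for y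
    proof -
      obtain s where s: "s \<in> chain.span R" "y - s \<in> B'" using R(1) \<open>y \<in> Z'\<close> by (auto simp: spans_modulo_def)
      have "s \<in> Z'" using chain.span_minimal[OF Rf(2) Z'] s(1) by blast
      then have "y - s \<in> chain.span S'" using s(2) that chain.subspace_diff[OF Z'] ST'(6) by blast
      then have "s + (y - s) \<in> chain.span (R \<union> S')" using s(1) unfolding chain.span_Un by blast
      then show ?thesis by simp
    qed
    then show ?thesis using T(2) ZZ ST'(5) by blast
  qed
  then have "card (\<phi> ` T \<union> S') \<le> card (R \<union> S')"
    using chain.independent_span_bound[OF _ ind(1)] Rf ST'(3) by blast
  also have "\<dots> \<le> card R + card S'" by (rule card_Un_le)
  finally have "card T \<le> card R" using ind(2) by simp
  moreover have "quotient_dim (quotient_space Z B) \<le> card T"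
    unfolding quotient_dim_eq[OF Z B] by (rule Least_le) (use ST(4) in blast)
  ultimately show ?thesis using R(2) by simp
qed

section \<open>Weights on homology\<close>

context annular_resolutions begin

abbreviation "cycles k \<equiv> {\<psi> \<in> CKh D k. boundary0 D \<psi> = 0}"
abbreviation "boundaries k \<equiv> boundary0 D ` CKh D k"

lemma boundary0_linear: "Vector_Spaces.linear cscale cscale (boundary0 D)"
  by unfold_locales
    (auto simp: boundary0_def cscale_def fun_eq_iff algebra_simps sum.distrib sum_distrib_left)

lemma shift_linear: "Vector_Spaces.linear cscale cscale (shift l)"
  by unfold_locales
    (auto simp: shift_def cscale_def fun_eq_iff algebra_simps sum.distrib sum_distrib_left)

lemma flip_linear: "Vector_Spaces.linear cscale cscale flip"
  by unfold_locales (auto simp: flip_def cscale_def fun_eq_iff)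

lemma CKhD: "\<psi> \<in> CKh D k \<Longrightarrow> \<psi> S \<noteq> 0 \<Longrightarrow> S \<in> states D \<and> k_grading D S = k"
  unfolding CKh_def by blast

lemma CKh_subspace: "chain.subspace (CKh D k)"
  unfolding chain.subspace_def by (force simp: CKh_def cscale_def)

lemma boundaries_subspace: "chain.subspace (boundaries k)"
proof -
  interpret d: Vector_Spaces.linear cscale cscale "boundary0 D" by (rule boundary0_linear)
  show ?thesis using d.subspace_image CKh_subspace by blast
qed

lemma cycles_subspace: "chain.subspace (cycles k)"
proof -
  interpret d: Vector_Spaces.linear cscale cscale "boundary0 D" by (rule boundary0_linear)
  show ?thesis
    using CKh_subspace[of k] unfolding chain.subspace_def by (auto simp: d.add d.scale d.zero)
qed

lemma CKh_span: "CKh D k \<subseteq> chain.span ((\<lambda>S T. if T = S then 1 else 0) ` states D)"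
proof
  fix \<psi> assume \<psi>: "\<psi> \<in> CKh D k"
  have sum_apply: "(\<Sum>S\<in>A. f S) T = (\<Sum>S\<in>A. f S T)" for A :: "state set" and f :: "state \<Rightarrow> state \<Rightarrow> complex" and T
    by (induction A rule: infinite_finite_induct) auto
  have "\<psi> = (\<Sum>S\<in>states D. cscale (\<psi> S) (\<lambda>T. if T = S then 1 else 0))"
  proof
    fix T
    have "T \<notin> states D \<Longrightarrow> \<psi> T = 0" using CKhD[OF \<psi>] by blast
    then show "\<psi> T = (\<Sum>S\<in>states D. cscale (\<psi> S) (\<lambda>T. if T = S then 1 else 0)) T"
      using finite_states by (cases "T \<in> states D") (simp_all add: sum_apply cscale_def if_distrib cong: if_cong)
  qed
  then show "\<psi> \<in> chain.span ((\<lambda>S T. if T = S then 1 else 0) ` states D)"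
    by (metis (no_types, lifting) chain.span_base chain.span_scale chain.span_sum imageI)
qed

text \<open>The last hypothesis is injectivity of the induced map on homology. Finiteness of the set
  of states provides the finite spanning sets.\<close>

lemma SKh_dim_mono:
  assumes "Vector_Spaces.linear cscale cscale \<phi>"
    and "\<And>\<psi>. \<psi> \<in> cycles k \<Longrightarrow> \<phi> \<psi> \<in> cycles k'"
    and "\<And>\<psi>. \<psi> \<in> cycles k \<Longrightarrow> \<phi> \<psi> \<in> boundaries k' \<Longrightarrow> \<psi> \<in> boundaries k"
  shows "quotient_dim (SKh D k) \<le> quotient_dim (SKh D k')"
  unfolding SKh_def
proof (rule quotient_dim_mono[OF cycles_subspace boundaries_subspace _ _ cycles_subspace boundaries_subspace _ _ assms])
  let ?F = "(\<lambda>S T. if T = S then 1 else 0) ` states D"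
  show "finite ?F" "finite ?F" using finite_states by auto
  show "cycles k \<subseteq> chain.span ?F" "cycles k' \<subseteq> chain.span ?F"
    by (rule subset_trans[OF _ CKh_span], blast)+
qed

lemma shift_cycles: "\<psi> \<in> cycles k \<Longrightarrow> shift l \<psi> \<in> cycles (k + 2 * label_weight l)"
proof -
  interpret s: Vector_Spaces.linear cscale cscale "shift l" by (rule shift_linear)
  show "\<psi> \<in> cycles k \<Longrightarrow> shift l \<psi> \<in> cycles (k + 2 * label_weight l)"
    using shift_CKh by (auto simp: boundary0_shift s.zero)
qed

lemma shift_boundaries: "\<psi> \<in> boundaries k \<Longrightarrow> shift l \<psi> \<in> boundaries (k + 2 * label_weight l)"
  using shift_CKh by (auto simp flip: boundary0_shift)

lemma SKh_dim_flip: "quotient_dim (SKh D k) \<le> quotient_dim (SKh D (- k))"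
proof (rule SKh_dim_mono[OF flip_linear])
  interpret f: Vector_Spaces.linear cscale cscale flip by (rule flip_linear)
  have ff: "flip (flip \<psi>) = \<psi>" for \<psi> by (rule ext) (auto simp: flip_eq)
  fix \<psi> assume "\<psi> \<in> cycles k"
  then show "flip \<psi> \<in> cycles (- k)" using flip_CKh by (auto simp: boundary0_flip f.zero)
  assume "flip \<psi> \<in> boundaries (- k)"
  then obtain \<phi> where "\<phi> \<in> CKh D (- k)" "flip \<psi> = boundary0 D \<phi>" by blast
  then have "flip \<phi> \<in> CKh D k" "\<psi> = boundary0 D (flip \<phi>)"
    using flip_CKh[of \<phi> "- k"] ff[of \<psi>] by (simp_all add: boundary0_flip)
  then show "\<psi> \<in> boundaries k" by blast
qed

section \<open>Lowering is injective on positive weights\<close>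

lemma shift_power_CKh: "\<psi> \<in> CKh D k \<Longrightarrow> (shift Plus ^^ m) \<psi> \<in> CKh D (k + 2 * int m)"
proof (induction m)
  case (Suc m)
  then show ?case using shift_CKh[of "(shift Plus ^^ m) \<psi>" "k + 2 * int m" Plus]
    by (simp add: label_weight_def algebra_simps)
qed simp

lemma shift_power_boundaries:
  "\<psi> \<in> boundaries k \<Longrightarrow> (shift Plus ^^ m) \<psi> \<in> boundaries (k + 2 * int m)"
proof (induction m)
  case (Suc m)
  then show ?case using shift_boundaries[of "(shift Plus ^^ m) \<psi>" "k + 2 * int m" Plus]
    by (simp add: label_weight_def algebra_simps)
qed simp

text \<open>Moving the lowering operator past each raising operator costs the weight
  \<open>k + 2j\<close> at that place; these add up to \<open>(m + 1) (k + m)\<close> for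
  \<open>j\<close> from 0 to \<open>m\<close>.\<close>

lemma lower_raise_power:
  assumes "\<psi> \<in> CKh D k"
  shows "shift Minus ((shift Plus ^^ Suc m) \<psi>) =
    (shift Plus ^^ Suc m) (shift Minus \<psi>) - cscale (of_int ((int m + 1) * (k + int m))) ((shift Plus ^^ m) \<psi>)"
proof -
  have comm: "shift Minus (shift Plus \<phi>) = shift Plus (shift Minus \<phi>) - cscale (of_int j) \<phi>"
    if "\<phi> \<in> CKh D j" for \<phi> j
  proof
    fix S
    have "of_int (k_grading D S) * \<phi> S = of_int j * \<phi> S"
      using CKhD[OF that, of S] by (cases "\<phi> S = 0") auto
    then show "shift Minus (shift Plus \<phi>) S = (shift Plus (shift Minus \<phi>) - cscale (of_int j) \<phi>) S"
      using shift_commutator[of \<phi> S] by (auto simp: cscale_def algebra_simps)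
  qed
  interpret s: Vector_Spaces.linear cscale cscale "shift Plus" by (rule shift_linear)
  show ?thesis
  proof (induction m)
    case 0
    then show ?case using comm[OF assms] by simp
  next
    case (Suc m)
    let ?e = "\<lambda>m. (shift Plus ^^ m) \<psi>"
    have "shift Minus (?e (Suc (Suc m))) = shift Plus (shift Minus (?e (Suc m))) - cscale (of_int (k + 2 * int (Suc m))) (?e (Suc m))"
      using comm[OF shift_power_CKh[OF assms, of "Suc m"]] by simp
    also have "shift Plus (shift Minus (?e (Suc m))) = (shift Plus ^^ Suc (Suc m)) (shift Minus \<psi>) -
        cscale (of_int ((int m + 1) * (k + int m))) (?e (Suc m))"
      unfolding Suc.IH by (simp add: s.diff s.scale)
    finally show ?case by (simp add: cscale_def fun_eq_iff algebra_simps)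
  qed
qed

lemma shift_power_vanishes: "\<exists>m. \<forall>\<psi>\<in>CKh D k. (shift Plus ^^ m) \<psi> = 0"
proof -
  have "finite (k_grading D ` states D)" using finite_states by simp
  then obtain b where b: "\<And>S. S \<in> states D \<Longrightarrow> k_grading D S \<le> b"
    using Max_ge by blast
  \<comment> \<open>This exponent lifts the weight above the bound \<open>b\<close>; if
    \<open>k\<close> exceeds \<open>b\<close> already, it is 0 and the chain itself
    vanishes.\<close>
  have "(shift Plus ^^ nat (b - k + 1)) \<psi> = 0" if "\<psi> \<in> CKh D k" for \<psi>
  proof
    fix S
    show "(shift Plus ^^ nat (b - k + 1)) \<psi> S = 0 S"
      using CKhD[OF shift_power_CKh[OF that, of "nat (b - k + 1)"], of S] b[of S]
      by (cases "(shift Plus ^^ nat (b - k + 1)) \<psi> S = 0") (auto split: if_splits)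
  qed
  then show ?thesis by blast
qed

text \<open>
  Since \<open>m (k + m - 1)\<close> is nonzero for \<open>m, k \<ge> 1\<close>, that \<open>(shift Plus ^^ m) \<psi>\<close> is a boundary descends
  from large \<open>m\<close>, where this chain vanishes, to \<open>m = 0\<close>.
\<close>

lemma lower_injective:
  assumes \<psi>: "\<psi> \<in> CKh D k" and k: "k \<ge> 1" and low: "shift Minus \<psi> \<in> boundaries (k - 2)"
  shows "\<psi> \<in> boundaries k"
proof -
  let ?e = "\<lambda>m. (shift Plus ^^ m) \<psi>"
  have step: "?e m \<in> boundaries (k + 2 * int m)" if "?e (Suc m) \<in> boundaries (k + 2 * int (Suc m))" for m
  proof -
    let ?c = "of_int ((int m + 1) * (k + int m)) :: complex"
    have "shift Minus (?e (Suc m)) \<in> boundaries (k + 2 * int m)"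
      using shift_boundaries[OF that, of Minus] by (simp add: label_weight_def)
    moreover have "(shift Plus ^^ Suc m) (shift Minus \<psi>) \<in> boundaries (k + 2 * int m)"
      using shift_power_boundaries[OF low, of "Suc m"] by (simp add: algebra_simps)
    \<comment> \<open>The relation solved for the lower power: both terms on the right are
      boundaries, and \<open>?c\<close> is invertible because \<open>k\<close> is positive.\<close>
    moreover have "cscale ?c (?e m) = (shift Plus ^^ Suc m) (shift Minus \<psi>) - shift Minus (?e (Suc m))"
      unfolding lower_raise_power[OF \<psi>] by simp
    ultimately have "cscale ?c (?e m) \<in> boundaries (k + 2 * int m)"
      using chain.subspace_diff[OF boundaries_subspace] by simp
    then have "cscale (inverse ?c) (cscale ?c (?e m)) \<in> boundaries (k + 2 * int m)"
      by (rule chain.subspace_scale[OF boundaries_subspace])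
    moreover have "(int m + 1) * (k + int m) \<noteq> 0" using k by auto
    then have "?c \<noteq> 0" unfolding of_int_eq_0_iff .
    ultimately show ?thesis by (simp del: of_int_mult)
  qed
  obtain m where "?e m = 0" using shift_power_vanishes \<psi> by blast
  then have "?e m \<in> boundaries (k + 2 * int m)" using chain.subspace_0[OF boundaries_subspace] by simp
  then have "?e 0 \<in> boundaries (k + 2 * int 0)"
  proof (induction m)
    case (Suc m)
    then show ?case using step by blast
  qed
  then show ?thesis by simp
qed

lemma SKh_dim_lower:
  assumes "k \<ge> 1" shows "quotient_dim (SKh D k) \<le> quotient_dim (SKh D (k - 2))"
proof (rule SKh_dim_mono[OF shift_linear[of Minus]])
  fix \<psi> assume \<psi>: "\<psi> \<in> cycles k"
  show "shift Minus \<psi> \<in> cycles (k - 2)" using shift_cycles[OF \<psi>, of Minus] by (simp add: label_weight_def)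
  show "\<psi> \<in> boundaries k" if "shift Minus \<psi> \<in> boundaries (k - 2)"
    using lower_injective \<psi> assms that by blast
qed

lemma SKh_dim_decreasing:
  assumes "k \<ge> 0" shows "quotient_dim (SKh D (k + 2 * int m)) \<le> quotient_dim (SKh D k)"
proof (induction m)
  case (Suc m)
  then show ?case using SKh_dim_lower[of "k + 2 * int (Suc m)"] assms by simp
qed simp

lemma SKh_dim_abs: "quotient_dim (SKh D \<bar>k\<bar>) = quotient_dim (SKh D k)"
  using SKh_dim_flip[of k] SKh_dim_flip[of "- k"] by (cases "k \<ge> 0") auto

end

theorem corollary1:
  fixes L :: "(complex \<times> real) set" and D :: diagram and k k' :: int
  assumes "annular_link L" and "diagram_of L D"
    and "k mod 2 = k' mod 2" and "\<bar>k\<bar> \<le> \<bar>k'\<bar>"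
  shows "quotient_dim (SKh D k) \<ge> quotient_dim (SKh D k')"
proof -
  interpret annular_resolutions D
    using assms(2) by unfold_locales (simp add: diagram_of_def)
  have "even (\<bar>k'\<bar> - \<bar>k\<bar>)" using assms(3) by presburger
  then obtain j where "\<bar>k'\<bar> - \<bar>k\<bar> = 2 * j" by (elim evenE)
  then have "\<bar>k'\<bar> = \<bar>k\<bar> + 2 * int (nat j)" using assms(4) by simp
  then show ?thesis
    using SKh_dim_decreasing[of "\<bar>k\<bar>" "nat j"] SKh_dim_abs[of k] SKh_dim_abs[of k'] by (simp only: abs_ge_zero simp_thms)
qed

end
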